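(* Let $\Gamma$ be a groupoid, let $R$ be a $d$-finitely generated $\Gamma$-graded ring, and write $R=\sum_{e\in\Delta_0}R1_eR$ for a finite subset $\Delta_0\subseteq\Gamma_0$. Set $R_\Delta=\bigoplus_{e,e'\in\Delta_0}1_eR1_{e'}$. The following statements are equivalent: (1) $R$ is a right $\Gamma_0$-artinian (resp. right $\Gamma_0$-noetherian, gr-semisimple) ring. (2) $R_\Delta$ is a right gr-artinian (resp. right gr-noetherian, gr-semisimple) ring. (3) $R(e)$ is a gr-artinian (resp. gr-noetherian, gr-semisimple) right $R$-module for all $e\in\Delta_0$.
   Context: A groupoid $\Gamma$ is the set of morphisms of a small category in which all morphisms are invertible; $\Gamma_0\subseteq\Gamma$ is the set of identity morphisms; $d(\gamma)=\gamma^{-1}\gamma$, $r(\gamma)=\gamma\gamma^{-1}$; the product $\gamma\delta$ is defined iff $d(\gamma)=r(\delta)$. Rings are associative, not necessarily unital. A $\Gamma$-graded ring is a ring $R=\bigoplus_{\gamma\in\Gamma}R_\gamma$ (additive subgroups) with $R_\gamma R_\delta\subseteq R_{\gamma\delta}$ if $d(\gamma)=r(\delta)$ and $R_\gamma R_\delta=0$ otherwise; it is always assumed object unital: for each $e\in\Gamma_0$ the ring $R_e$ has an identity $1_e$ (possibly $0$) with $1_{r(\gamma)}a=a=a1_{d(\gamma)}$ for all $a\in R_\gamma$, $\gamma\in\Gamma$. A right ideal $U$ is graded if $U=\bigoplus_\gamma (U\cap R_\gamma)$. For $e\in\Gamma_0$, $R(e)=1_eR=\bigoplus_{r(\gamma)=e}R_\gamma$,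 a graded right ideal; its graded submodules are the graded right ideals of $R$ it contains. $R_\Delta$ is a $\Gamma$-graded ring with $(R_\Delta)_\gamma=R_\gamma$ if $r(\gamma),d(\gamma)\in\Delta_0$ and $0$ otherwise. $R$ is $d$-finitely generated if $R=\sum_{e\in\Delta_0}R1_eR$ for some finite $\Delta_0\subseteq\Gamma_0$. A graded right module (such as $R(e)$, or a graded ring as right module over itself) is gr-artinian (gr-noetherian) if it has no infinite strictly decreasing (increasing) chain of graded submodules, and gr-semisimple if it is a sum of gr-simple graded submodules, where a nonzero graded module is gr-simple if its only graded submodules are $0$ and itself. A graded ring is right gr-artinian / right gr-noetherian / gr-semisimple if it is gr-artinian / gr-noetherian / gr-semisimple as a right module over itself. $R$ is right $\Gamma_0$-artinian (noetherian) if $R(e)$ is gr-artinian (gr-noetherian) for every $e\in\Gamma_0$. *)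

theory Defs
  imports Main "HOL-Computational_Algebra.Group_Closure"
begin

(* A category is given by its set of morphisms alone: an object is identified with its identity
   morphism, so Src and Tgt (d and r in the mathematical text) are themselves morphisms.  Comp g h
   is meaningful only if Src g = Tgt h.  The axiom inverse says in particular that
   Src g = g^(-1) g and Tgt g = g g^(-1). *)

record 'g arrows =
  Mor :: "'g set"
  Src :: "'g \<Rightarrow> 'g"
  Tgt :: "'g \<Rightarrow> 'g"
  Comp :: "'g \<Rightarrow> 'g \<Rightarrow> 'g"

locale groupoid =
  fixes \<Gamma> :: "'g arrows"
  assumes Src_closed: "g \<in> Mor \<Gamma> \<Longrightarrow> Src \<Gamma> g \<in> Mor \<Gamma>"
    and Tgt_closed: "g \<in> Mor \<Gamma> \<Longrightarrow> Tgt \<Gamma> g \<in> Mor \<Gamma>"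
    and Src_Src: "g \<in> Mor \<Gamma> \<Longrightarrow> Src \<Gamma> (Src \<Gamma> g) = Src \<Gamma> g"
    and Tgt_Src: "g \<in> Mor \<Gamma> \<Longrightarrow> Tgt \<Gamma> (Src \<Gamma> g) = Src \<Gamma> g"
    and Src_Tgt: "g \<in> Mor \<Gamma> \<Longrightarrow> Src \<Gamma> (Tgt \<Gamma> g) = Tgt \<Gamma> g"
    and Tgt_Tgt: "g \<in> Mor \<Gamma> \<Longrightarrow> Tgt \<Gamma> (Tgt \<Gamma> g) = Tgt \<Gamma> g"
    and Comp_closed: "\<lbrakk>g \<in> Mor \<Gamma>; h \<in> Mor \<Gamma>; Src \<Gamma> g = Tgt \<Gamma> h\<rbrakk> \<Longrightarrow> Comp \<Gamma> g h \<in> Mor \<Gamma>"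
    and Src_Comp: "\<lbrakk>g \<in> Mor \<Gamma>; h \<in> Mor \<Gamma>; Src \<Gamma> g = Tgt \<Gamma> h\<rbrakk> \<Longrightarrow> Src \<Gamma> (Comp \<Gamma> g h) = Src \<Gamma> h"
    and Tgt_Comp: "\<lbrakk>g \<in> Mor \<Gamma>; h \<in> Mor \<Gamma>; Src \<Gamma> g = Tgt \<Gamma> h\<rbrakk> \<Longrightarrow> Tgt \<Gamma> (Comp \<Gamma> g h) = Tgt \<Gamma> g"
    and Comp_assoc: "\<lbrakk>g \<in> Mor \<Gamma>; h \<in> Mor \<Gamma>; k \<in> Mor \<Gamma>; Src \<Gamma> g = Tgt \<Gamma> h; Src \<Gamma> h = Tgt \<Gamma> k\<rbrakk>
      \<Longrightarrow> Comp \<Gamma> (Comp \<Gamma> g h) k = Comp \<Gamma> g (Comp \<Gamma> h k)"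
    and Comp_Tgt: "g \<in> Mor \<Gamma> \<Longrightarrow> Comp \<Gamma> (Tgt \<Gamma> g) g = g"
    and Comp_Src: "g \<in> Mor \<Gamma> \<Longrightarrow> Comp \<Gamma> g (Src \<Gamma> g) = g"
    and inverse: "g \<in> Mor \<Gamma> \<Longrightarrow> \<exists>h\<in>Mor \<Gamma>. Src \<Gamma> h = Tgt \<Gamma> g \<and> Tgt \<Gamma> h = Src \<Gamma> g
      \<and> Comp \<Gamma> h g = Src \<Gamma> g \<and> Comp \<Gamma> g h = Tgt \<Gamma> g"

definition idents :: "'g arrows \<Rightarrow> 'g set" where
  "idents \<Gamma> = {e \<in> Mor \<Gamma>. Src \<Gamma> e = e}"

definition add_subgroup :: "'a::ab_group_add set \<Rightarrow> bool" where
  "add_subgroup S \<longleftrightarrow> 0 \<in> S \<and> (\<forall>x\<in>S. \<forall>y\<in>S. x - y \<in> S)"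

(* The sum of a family of additive subgroups, i.e. the additive subgroup they generate. *)
definition subgroup_sum :: "'i set \<Rightarrow> ('i \<Rightarrow> 'a::ab_group_add set) \<Rightarrow> 'a set" where
  "subgroup_sum I B = group_closure (\<Union>i\<in>I. B i)"

definition independent_family :: "'i set \<Rightarrow> ('i \<Rightarrow> 'a::ab_group_add set) \<Rightarrow> bool" where
  "independent_family I B \<longleftrightarrow> (\<forall>F x. finite F \<and> F \<subseteq> I \<and> (\<forall>i\<in>F. x i \<in> B i) \<and> (\<Sum>i\<in>F. x i) = 0
     \<longrightarrow> (\<forall>i\<in>F. x i = 0))"

definition direct_sum :: "'a::ab_group_add set \<Rightarrow> 'i set \<Rightarrow> ('i \<Rightarrow> 'a set) \<Rightarrow> bool" where
  "direct_sum S I B \<longleftrightarrow> S = subgroup_sum I B \<and> independent_family I B"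

(* The type class ring does not require a unit.  A graded ring is a subring R of the ambient type
   together with its homogeneous components A; a carrier is needed because R_Delta below
   is again a graded ring. *)
locale graded_ring = groupoid \<Gamma> for \<Gamma> :: "'g arrows" +
  fixes R :: "'r::ring set" and A :: "'g \<Rightarrow> 'r set"
  assumes subgroup: "g \<in> Mor \<Gamma> \<Longrightarrow> add_subgroup (A g)"
    and decomposition: "direct_sum R (Mor \<Gamma>) A"
    and mult_in: "\<lbrakk>g \<in> Mor \<Gamma>; h \<in> Mor \<Gamma>; Src \<Gamma> g = Tgt \<Gamma> h; a \<in> A g; b \<in> A h\<rbrakk>
      \<Longrightarrow> a * b \<in> A (Comp \<Gamma> g h)"
    and mult_zero: "\<lbrakk>g \<in> Mor \<Gamma>; h \<in> Mor \<Gamma>; Src \<Gamma> g \<noteq> Tgt \<Gamma> h; a \<in> A g; b \<in> A h\<rbrakk>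
      \<Longrightarrow> a * b = 0"
    and object_unital: "e \<in> idents \<Gamma> \<Longrightarrow> \<exists>u\<in>A e.
      \<forall>g\<in>Mor \<Gamma>. \<forall>a\<in>A g. (Tgt \<Gamma> g = e \<longrightarrow> u * a = a) \<and> (Src \<Gamma> g = e \<longrightarrow> a * u = a)"

(* 1_e, the identity of the ring A e (unique once it exists) *)
definition one_at :: "('g \<Rightarrow> 'r::ring set) \<Rightarrow> 'g \<Rightarrow> 'r" where
  "one_at A e = (THE u. u \<in> A e \<and> (\<forall>a\<in>A e. u * a = a \<and> a * u = a))"

definition graded_right_ideal :: "'g arrows \<Rightarrow> 'r::ring set \<Rightarrow> ('g \<Rightarrow> 'r set) \<Rightarrow> 'r set \<Rightarrow> bool" where
  "graded_right_ideal \<Gamma> R A U \<longleftrightarrow> U \<subseteq> R \<and> add_subgroup U \<and> (\<forall>u\<in>U. \<forall>a\<in>R. u * a \<in> U)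
     \<and> direct_sum U (Mor \<Gamma>) (\<lambda>g. U \<inter> A g)"

(* The module notions below are meant for a module M that is itself a graded right ideal of R
   (R or some R(e)), for which the graded submodules are the graded right ideals inside M. *)
definition graded_submodule ::
  "'g arrows \<Rightarrow> 'r::ring set \<Rightarrow> ('g \<Rightarrow> 'r set) \<Rightarrow> 'r set \<Rightarrow> 'r set \<Rightarrow> bool" where
  "graded_submodule \<Gamma> R A M U \<longleftrightarrow> graded_right_ideal \<Gamma> R A U \<and> U \<subseteq> M"

definition gr_artinian :: "'g arrows \<Rightarrow> 'r::ring set \<Rightarrow> ('g \<Rightarrow> 'r set) \<Rightarrow> 'r set \<Rightarrow> bool" where
  "gr_artinian \<Gamma> R A M \<longleftrightarrow>
     \<not> (\<exists>U :: nat \<Rightarrow> 'r set. (\<forall>n. graded_submodule \<Gamma> R A M (U n)) \<and> (\<forall>n. U (Suc n) \<subset> U n))"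

definition gr_noetherian :: "'g arrows \<Rightarrow> 'r::ring set \<Rightarrow> ('g \<Rightarrow> 'r set) \<Rightarrow> 'r set \<Rightarrow> bool" where
  "gr_noetherian \<Gamma> R A M \<longleftrightarrow>
     \<not> (\<exists>U :: nat \<Rightarrow> 'r set. (\<forall>n. graded_submodule \<Gamma> R A M (U n)) \<and> (\<forall>n. U n \<subset> U (Suc n)))"

definition gr_simple :: "'g arrows \<Rightarrow> 'r::ring set \<Rightarrow> ('g \<Rightarrow> 'r set) \<Rightarrow> 'r set \<Rightarrow> bool" where
  "gr_simple \<Gamma> R A M \<longleftrightarrow> M \<noteq> {0} \<and> (\<forall>U. graded_submodule \<Gamma> R A M U \<longrightarrow> U = {0} \<or> U = M)"

(* The zero module, being the empty sum, is gr-semisimple. *)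
definition gr_semisimple :: "'g arrows \<Rightarrow> 'r::ring set \<Rightarrow> ('g \<Rightarrow> 'r set) \<Rightarrow> 'r set \<Rightarrow> bool" where
  "gr_semisimple \<Gamma> R A M \<longleftrightarrow>
     (\<exists>\<S>. (\<forall>S\<in>\<S>. graded_submodule \<Gamma> R A M S \<and> gr_simple \<Gamma> R A S) \<and> M = subgroup_sum \<S> (\<lambda>S. S))"

definition right_gr_artinian_ring :: "'g arrows \<Rightarrow> 'r::ring set \<Rightarrow> ('g \<Rightarrow> 'r set) \<Rightarrow> bool" where
  "right_gr_artinian_ring \<Gamma> R A \<longleftrightarrow> gr_artinian \<Gamma> R A R"

definition right_gr_noetherian_ring :: "'g arrows \<Rightarrow> 'r::ring set \<Rightarrow> ('g \<Rightarrow> 'r set) \<Rightarrow> bool" where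
  "right_gr_noetherian_ring \<Gamma> R A \<longleftrightarrow> gr_noetherian \<Gamma> R A R"

definition gr_semisimple_ring :: "'g arrows \<Rightarrow> 'r::ring set \<Rightarrow> ('g \<Rightarrow> 'r set) \<Rightarrow> bool" where
  "gr_semisimple_ring \<Gamma> R A \<longleftrightarrow> gr_semisimple \<Gamma> R A R"

(* R(e) = 1_e R *)
definition right_piece :: "'r::ring set \<Rightarrow> ('g \<Rightarrow> 'r set) \<Rightarrow> 'g \<Rightarrow> 'r set" where
  "right_piece R A e = {one_at A e * a | a. a \<in> R}"

definition right_objectwise_artinian ::
  "'g arrows \<Rightarrow> 'r::ring set \<Rightarrow> ('g \<Rightarrow> 'r set) \<Rightarrow> bool" where
  "right_objectwise_artinian \<Gamma> R A \<longleftrightarrow> (\<forall>e\<in>idents \<Gamma>. gr_artinian \<Gamma> R A (right_piece R A e))"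

definition right_objectwise_noetherian ::
  "'g arrows \<Rightarrow> 'r::ring set \<Rightarrow> ('g \<Rightarrow> 'r set) \<Rightarrow> bool" where
  "right_objectwise_noetherian \<Gamma> R A \<longleftrightarrow> (\<forall>e\<in>idents \<Gamma>. gr_noetherian \<Gamma> R A (right_piece R A e))"

(* R 1_e R *)
definition one_ideal :: "'r::ring set \<Rightarrow> ('g \<Rightarrow> 'r set) \<Rightarrow> 'g \<Rightarrow> 'r set" where
  "one_ideal R A e = group_closure {a * one_at A e * b | a b. a \<in> R \<and> b \<in> R}"

definition d_generating ::
  "'g arrows \<Rightarrow> 'r::ring set \<Rightarrow> ('g \<Rightarrow> 'r set) \<Rightarrow> 'g set \<Rightarrow> bool" where
  "d_generating \<Gamma> R A \<Delta> \<longleftrightarrow> finite \<Delta> \<and> \<Delta> \<subseteq> idents \<Gamma> \<and> R = subgroup_sum \<Delta> (one_ideal R A)"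

definition d_finitely_generated :: "'g arrows \<Rightarrow> 'r::ring set \<Rightarrow> ('g \<Rightarrow> 'r set) \<Rightarrow> bool" where
  "d_finitely_generated \<Gamma> R A \<longleftrightarrow> (\<exists>\<Delta>. d_generating \<Gamma> R A \<Delta>)"

definition corner_ring :: "'r::ring set \<Rightarrow> ('g \<Rightarrow> 'r set) \<Rightarrow> 'g set \<Rightarrow> 'r set" where
  "corner_ring R A \<Delta> =
     subgroup_sum (\<Delta> \<times> \<Delta>) (\<lambda>(e, e'). {one_at A e * a * one_at A e' | a. a \<in> R})"

definition corner_grading ::
  "'g arrows \<Rightarrow> ('g \<Rightarrow> 'r::ring set) \<Rightarrow> 'g set \<Rightarrow> 'g \<Rightarrow> 'r set" where
  "corner_grading \<Gamma> A \<Delta> g = (if Tgt \<Gamma> g \<in> \<Delta> \<and> Src \<Gamma> g \<in> \<Delta> then A g else {0})"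

lemma group_closure_mono: "S \<subseteq> T \<Longrightarrow> group_closure S \<subseteq> group_closure (T :: 'a::ab_group_add set)"
proof
  fix x assume "S \<subseteq> T" "x \<in> group_closure S"
  from this(2) show "x \<in> group_closure T"
    by induction (use \<open>S \<subseteq> T\<close> in \<open>auto intro: group_closure.intros\<close>)
qed

lemma group_closure_least: "S \<subseteq> T \<Longrightarrow> add_subgroup T \<Longrightarrow> group_closure S \<subseteq> T"
proof
  fix x assume "S \<subseteq> T" "add_subgroup T" "x \<in> group_closure S"
  from this(3) show "x \<in> T"
    by induction (use \<open>S \<subseteq> T\<close> \<open>add_subgroup T\<close> in \<open>auto simp: add_subgroup_def\<close>)
qed

lemma add_subgroup_group_closure: "add_subgroup (group_closure S)"
  by (auto simp: add_subgroup_def intro: group_closure.diff)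

lemma independent_family_mono:
  "independent_family I B \<Longrightarrow> (\<And>i. i \<in> I \<Longrightarrow> C i \<subseteq> B i) \<Longrightarrow> independent_family I C"
  unfolding independent_family_def by (meson subsetD)

context graded_ring begin

lemma idents_Src: "g \<in> Mor \<Gamma> \<Longrightarrow> Src \<Gamma> g \<in> idents \<Gamma>"
  and idents_Tgt: "g \<in> Mor \<Gamma> \<Longrightarrow> Tgt \<Gamma> g \<in> idents \<Gamma>"
  by (simp_all add: idents_def Src_closed Tgt_closed Src_Src Src_Tgt)

lemma identsD: "e \<in> idents \<Gamma> \<Longrightarrow> e \<in> Mor \<Gamma> \<and> Src \<Gamma> e = e \<and> Tgt \<Gamma> e = e"
  unfolding idents_def using Tgt_Src by force

lemma one_at:
  assumes e: "e \<in> idents \<Gamma>"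
  shows one_at_in: "one_at A e \<in> A e"
    and one_at_left: "\<And>g a. g \<in> Mor \<Gamma> \<Longrightarrow> a \<in> A g \<Longrightarrow> one_at A e * a = (if Tgt \<Gamma> g = e then a else 0)"
    and one_at_right: "\<And>g a. g \<in> Mor \<Gamma> \<Longrightarrow> a \<in> A g \<Longrightarrow> a * one_at A e = (if Src \<Gamma> g = e then a else 0)"
proof -
  obtain u where u: "u \<in> A e" "\<And>g a. g\<in>Mor \<Gamma> \<Longrightarrow> a\<in>A g \<Longrightarrow> (Tgt \<Gamma> g = e \<longrightarrow> u * a = a) \<and> (Src \<Gamma> g = e \<longrightarrow> a * u = a)"
    using object_unital[OF e] by blast
  have "one_at A e = u" unfolding one_at_def
  proof (rule the_equality)
    show "u \<in> A e \<and> (\<forall>a\<in>A e. u * a = a \<and> a * u = a)" using u identsD[OF e] by blast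
    fix v assume "v \<in> A e \<and> (\<forall>a\<in>A e. v * a = a \<and> a * v = a)"
    then have v: "v \<in> A e" "v * u = u" using u by auto
    from u(2)[of e v] identsD[OF e] v(1) have "v * u = v" by auto
    with v show "v = u" by simp
  qed
  then show "one_at A e \<in> A e"
    "\<And>g a. g \<in> Mor \<Gamma> \<Longrightarrow> a \<in> A g \<Longrightarrow> one_at A e * a = (if Tgt \<Gamma> g = e then a else 0)"
    "\<And>g a. g \<in> Mor \<Gamma> \<Longrightarrow> a \<in> A g \<Longrightarrow> a * one_at A e = (if Src \<Gamma> g = e then a else 0)"
    using u mult_zero[of e _ u] mult_zero[of _ e _ u] identsD[OF e] by auto
qed

lemma R_eq: "R = group_closure (\<Union>g\<in>Mor \<Gamma>. A g)"
  using decomposition by (simp add: direct_sum_def subgroup_sum_def)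

lemma zero_in: "g \<in> Mor \<Gamma> \<Longrightarrow> 0 \<in> A g"
  using subgroup by (auto simp: add_subgroup_def)

lemma A_sub_R: "g \<in> Mor \<Gamma> \<Longrightarrow> a \<in> A g \<Longrightarrow> a \<in> R"
  unfolding R_eq by (auto intro: group_closure.base)

lemma R_diff: "x \<in> R \<Longrightarrow> y \<in> R \<Longrightarrow> x - y \<in> R"
  unfolding R_eq by (rule group_closure.diff)

lemma R_mult: assumes "x \<in> R" "y \<in> R" shows "x * y \<in> R"
proof -
  have *: "a * y \<in> R" if "g \<in> Mor \<Gamma>" "a \<in> A g" for g a
    using assms(2) unfolding R_eq
  proof induction
    case (base s)
    then show ?case
    proof (cases "s = 0")
      case False
      then obtain h where h: "h \<in> Mor \<Gamma>" "s \<in> A h" using base by auto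
      show ?thesis using mult_in[OF that(1) h(1) _ that(2) h(2)] mult_zero[OF that(1) h(1) _ that(2) h(2)]
          Comp_closed[OF that(1) h(1)] group_closure.base
        by (cases "Src \<Gamma> g = Tgt \<Gamma> h") (auto simp: R_eq[symmetric] intro: A_sub_R, simp add: R_eq)
    qed (auto)
  qed (auto simp: algebra_simps intro: group_closure.diff)
  show ?thesis using assms(1) unfolding R_eq
  proof induction
    case (base s)
    then show ?case using * by (auto simp: R_eq[symmetric]) (simp add: R_eq)
  next
    case (diff s t)
    then show ?case by (auto simp: algebra_simps intro: group_closure.diff)
  qed
qed

lemma R_subgroup: "add_subgroup R"
  unfolding R_eq by (rule add_subgroup_group_closure)

lemma right_piece_eq:
  assumes e: "e \<in> idents \<Gamma>"
  shows "right_piece R A e = group_closure (\<Union>g\<in>{g\<in>Mor \<Gamma>. Tgt \<Gamma> g = e}. A g)"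
proof (intro equalityI subsetI)
  fix x assume "x \<in> right_piece R A e"
  then obtain a where x: "x = one_at A e * a" "a \<in> R" unfolding right_piece_def by blast
  from x(2)[unfolded R_eq] have "one_at A e * a \<in> group_closure (\<Union>g\<in>{g\<in>Mor \<Gamma>. Tgt \<Gamma> g = e}. A g)"
  proof induction
    case (base s)
    then show ?case by (cases "s = 0") (auto simp: one_at_left[OF e] intro!: group_closure.base)
  qed (auto simp: algebra_simps intro: group_closure.diff)
  then show "x \<in> group_closure (\<Union>g\<in>{g\<in>Mor \<Gamma>. Tgt \<Gamma> g = e}. A g)" using x by simp
next
  fix x assume "x \<in> group_closure (\<Union>g\<in>{g\<in>Mor \<Gamma>. Tgt \<Gamma> g = e}. A g)"
  then have "one_at A e * x = x \<and> x \<in> R"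
    by induction (auto simp: one_at_left idents_Tgt algebra_simps intro: R_diff A_sub_R, simp add: R_eq)
  then show "x \<in> right_piece R A e" unfolding right_piece_def by force
qed

lemma graded_right_ideal_right_piece:
  assumes e: "e \<in> idents \<Gamma>"
  shows "graded_right_ideal \<Gamma> R A (right_piece R A e)"
proof -
  let ?U = "right_piece R A e"
  have sg: "add_subgroup ?U" unfolding right_piece_eq[OF e] by (rule add_subgroup_group_closure)
  have eR: "one_at A e \<in> R" using A_sub_R identsD[OF e] one_at_in[OF e] by blast
  have "?U = group_closure (\<Union>g\<in>Mor \<Gamma>. ?U \<inter> A g)"
  proof
    show "?U \<subseteq> group_closure (\<Union>g\<in>Mor \<Gamma>. ?U \<inter> A g)"
      by (subst (1) right_piece_eq[OF e], rule group_closure_mono)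
        (auto simp: right_piece_eq[OF e] intro!: group_closure.base)
  qed (use sg in \<open>intro group_closure_least, auto\<close>)
  moreover have "independent_family (Mor \<Gamma>) (\<lambda>g. ?U \<inter> A g)"
    using decomposition unfolding direct_sum_def by (blast intro: independent_family_mono)
  moreover have "?U \<subseteq> R" using eR R_mult by (auto simp: right_piece_def)
  moreover have "u * a \<in> ?U" if "u \<in> ?U" "a \<in> R" for u a
    using that R_mult by (fastforce simp: right_piece_def mult.assoc)
  ultimately show ?thesis using sg by (auto simp: graded_right_ideal_def direct_sum_def subgroup_sum_def)
qed

lemma graded_ring_corner:
  assumes D: "\<Delta> \<subseteq> idents \<Gamma>"
  shows "graded_ring \<Gamma> (corner_ring R A \<Delta>) (corner_grading \<Gamma> A \<Delta>)"
proof unfold_locales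
  let ?C = "group_closure (\<Union>g\<in>Mor \<Gamma>. corner_grading \<Gamma> A \<Delta> g)"
  have 1: "one_at A e * a * one_at A e' \<in> ?C" if "e \<in> \<Delta>" "e' \<in> \<Delta>" "a \<in> R" for e e' a
    using that(3) unfolding R_eq
  proof induction
    case (base s)
    have "e \<in> idents \<Gamma>" "e' \<in> idents \<Gamma>" using that D by auto
    then show ?case using base that
      by (auto simp: one_at_left one_at_right corner_grading_def intro!: group_closure.base)
  qed (auto simp: algebra_simps intro: group_closure.diff)
  have 2: "a \<in> corner_ring R A \<Delta>" if "g \<in> Mor \<Gamma>" "a \<in> corner_grading \<Gamma> A \<Delta> g" for g a
  proof (cases "Tgt \<Gamma> g \<in> \<Delta> \<and> Src \<Gamma> g \<in> \<Delta>")
    case True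
    then have a: "a \<in> A g" using that by (simp add: corner_grading_def)
    then have "a = one_at A (Tgt \<Gamma> g) * a * one_at A (Src \<Gamma> g)"
      using that by (simp add: one_at_left one_at_right idents_Src idents_Tgt)
    then show ?thesis using True A_sub_R[OF that(1) a]
      unfolding corner_ring_def subgroup_sum_def by (intro group_closure.base) blast
  qed (use that in \<open>auto simp: corner_grading_def corner_ring_def subgroup_sum_def\<close>)
  have "corner_ring R A \<Delta> = ?C"
  proof
    show "corner_ring R A \<Delta> \<subseteq> ?C" unfolding corner_ring_def subgroup_sum_def
      by (intro group_closure_least add_subgroup_group_closure) (use 1 in auto)
    show "?C \<subseteq> corner_ring R A \<Delta>"
      by (intro group_closure_least) (use 2 in \<open>auto simp: corner_ring_def subgroup_sum_def intro: add_subgroup_group_closure\<close>)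
  qed
  moreover have "independent_family (Mor \<Gamma>) (corner_grading \<Gamma> A \<Delta>)"
    using decomposition unfolding direct_sum_def
    by (auto intro!: independent_family_mono[of "Mor \<Gamma>" A] simp: corner_grading_def zero_in split: if_splits)
  ultimately show "direct_sum (corner_ring R A \<Delta>) (Mor \<Gamma>) (corner_grading \<Gamma> A \<Delta>)"
    by (simp add: direct_sum_def subgroup_sum_def)
next
  fix g assume "g \<in> Mor \<Gamma>"
  then show "add_subgroup (corner_grading \<Gamma> A \<Delta> g)"
    using subgroup by (auto simp: corner_grading_def add_subgroup_def)
next
  fix g h a b assume *: "g \<in> Mor \<Gamma>" "h \<in> Mor \<Gamma>" "Src \<Gamma> g = Tgt \<Gamma> h"
    "a \<in> corner_grading \<Gamma> A \<Delta> g" "b \<in> corner_grading \<Gamma> A \<Delta> h"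
  then show "a * b \<in> corner_grading \<Gamma> A \<Delta> (Comp \<Gamma> g h)"
    using mult_in[OF *(1-3), of a b] zero_in[OF Comp_closed[OF *(1-3)]]
    by (auto simp: corner_grading_def Src_Comp Tgt_Comp split: if_splits)
next
  fix g h a b assume *: "g \<in> Mor \<Gamma>" "h \<in> Mor \<Gamma>" "Src \<Gamma> g \<noteq> Tgt \<Gamma> h"
    "a \<in> corner_grading \<Gamma> A \<Delta> g" "b \<in> corner_grading \<Gamma> A \<Delta> h"
  then show "a * b = 0" using mult_zero[OF *(1-3), of a b]
    by (auto simp: corner_grading_def split: if_splits)
next
  fix e assume e: "e \<in> idents \<Gamma>"
  show "\<exists>u\<in>corner_grading \<Gamma> A \<Delta> e. \<forall>g\<in>Mor \<Gamma>. \<forall>a\<in>corner_grading \<Gamma> A \<Delta> g.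
     (Tgt \<Gamma> g = e \<longrightarrow> u * a = a) \<and> (Src \<Gamma> g = e \<longrightarrow> a * u = a)"
  proof (cases "e \<in> \<Delta>")
    case True
    then show ?thesis using object_unital[OF e] identsD[OF e]
      by (fastforce simp: corner_grading_def)
  qed (use e identsD[OF e] in \<open>auto simp: corner_grading_def\<close>)
qed

end

end

theory Submission
  imports Defs
begin

text \<open>Let \<open>u\<close> be the sum of the idempotents \<open>1\<^sub>e\<close> with \<open>e \<in> \<Delta>\<close>. Then \<open>R\<^sub>\<Delta> = u R u\<close>, and since
  \<open>R\<close> is the sum of the \<open>R 1\<^sub>e R\<close>, the maps \<open>U \<mapsto> U u\<close> and \<open>V \<mapsto> V R\<close> are mutually inverse isomorphisms
  between the lattice of graded right ideals of \<open>R\<close> inside \<open>u R = \<Sum>\<^sub>e R(e)\<close> and the lattice of graded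
  right ideals of \<open>R\<^sub>\<Delta>\<close>; they preserve strict inclusions and sums. This compares (2) with (3). To get from
  \<open>\<Delta>\<close> to all objects, every \<open>x \<in> R\<close> lies in a finite sum of right ideals \<open>a R(e)\<close> with \<open>a\<close> homogeneous
  and \<open>e \<in> \<Delta>\<close>. These are images of \<open>R(e)\<close> under graded maps, so they inherit the chain conditions
  and semisimplicity, and the chain conditions pass to finite sums and submodules. In particular
  \<open>R(f) = 1\<^sub>f R\<close> satisfies them for every object \<open>f\<close>.\<close>

section \<open>Additive subgroups and chain conditions\<close>

lemma add_subgroup_uminus: "add_subgroup S \<Longrightarrow> x \<in> S \<Longrightarrow> - x \<in> S"
  unfolding add_subgroup_def by (metis diff_0)

lemma add_subgroup_add: "add_subgroup S \<Longrightarrow> x \<in> S \<Longrightarrow> y \<in> S \<Longrightarrow> x + y \<in> S"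
  unfolding add_subgroup_def by (metis diff_0 diff_minus_eq_add)

lemma add_subgroup_sum: "add_subgroup S \<Longrightarrow> (\<And>i. i \<in> F \<Longrightarrow> f i \<in> S) \<Longrightarrow> sum f F \<in> S"
  by (induction F rule: infinite_finite_induct) (auto simp: add_subgroup_add, auto simp: add_subgroup_def)

lemma group_closure_zero: "0 \<in> group_closure S"
  by (rule group_closure.base) simp

lemma group_closure_incl: "x \<in> S \<Longrightarrow> x \<in> group_closure S"
  by (rule group_closure.base) simp

text \<open>A subtractive map sends 0 to 0, and 0 is the one element that
  \<open>group_closure\<close> adds to the generators, so only genuine generators need checking.
  Most inclusions below are verified in this way.\<close>

lemma group_closure_map:
  fixes f :: "'a::ab_group_add \<Rightarrow> 'b::ab_group_add"
  assumes "x \<in> group_closure S" "add_subgroup T" "\<And>x y. f (x - y) = f x - f y"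
    and "\<And>s. s \<in> S \<Longrightarrow> f s \<in> T"
  shows "f x \<in> T"
  using assms(1)
proof induction
  case (base s)
  then show ?case using assms(3)[of 0 0] assms(2,4) by (auto simp: add_subgroup_def)
next
  case (diff s t)
  then show ?case using assms(2,3) by (auto simp: add_subgroup_def)
qed

text \<open>An iterated difference of generators collapses to one summand per index because
  contributions from the same index stay in the same subgroup.\<close>

lemma group_closure_Union_decomposition:
  fixes B :: "'i \<Rightarrow> 'a::ab_group_add set"
  assumes "x \<in> group_closure (\<Union>i\<in>I. B i)" and B: "\<And>i. i \<in> I \<Longrightarrow> add_subgroup (B i)"
  shows "\<exists>F f. finite F \<and> F \<subseteq> I \<and> (\<forall>i\<in>F. f i \<in> B i) \<and> x = sum f F"
  using assms(1)
proof induction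
  case (base s)
  show ?case
  proof (cases "s = 0")
    case True
    then show ?thesis by (intro exI[of _ "{}"]) auto
  next
    case False
    then obtain i where "i \<in> I" "s \<in> B i" using base by auto
    then show ?thesis by (intro exI[of _ "{i}"] exI[of _ "\<lambda>_. s"]) auto
  qed
next
  case (diff s t)
  then obtain F f G g where F: "finite F" "F \<subseteq> I" "\<forall>i\<in>F. f i \<in> B i" "s = sum f F"
    and G: "finite G" "G \<subseteq> I" "\<forall>i\<in>G. g i \<in> B i" "t = sum g G" by blast
  \<comment> \<open>Both families are padded by 0 to the union of their supports, where they can be
    subtracted termwise.\<close>
  define h where "h i = (if i \<in> F then f i else 0) - (if i \<in> G then g i else 0)" for i
  have "sum h (F \<union> G) = (\<Sum>i\<in>F \<union> G. if i \<in> F then f i else 0) - (\<Sum>i\<in>F \<union> G. if i \<in> G then g i else 0)"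
    unfolding h_def by (rule sum_subtractf)
  also have "(\<Sum>i\<in>F \<union> G. if i \<in> F then f i else 0) = s"
    unfolding F(4) using F(1) G(1) by (intro sum.mono_neutral_cong_right) auto
  also have "(\<Sum>i\<in>F \<union> G. if i \<in> G then g i else 0) = t"
    unfolding G(4) using F(1) G(1) by (intro sum.mono_neutral_cong_right) auto
  finally have "s - t = sum h (F \<union> G)" ..
  moreover have "h i \<in> B i" if "i \<in> F \<union> G" for i
  proof -
    have "add_subgroup (B i)" using that B F(2) G(2) by blast
    then show ?thesis using that F(3) G(3) unfolding h_def add_subgroup_def by simp
  qed
  ultimately show ?case using F G by (intro exI[of _ "F \<union> G"] exI[of _ h]) auto
qed

lemma group_closure_Un:
  assumes "add_subgroup M" "add_subgroup N"
  shows "group_closure (M \<union> N) = {m + n | m n. m \<in> M \<and> n \<in> N}" (is "_ = ?S")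
proof
  have "add_subgroup ?S"
    unfolding add_subgroup_def
  proof (intro conjI ballI)
    show "0 \<in> ?S" using assms by (auto simp: add_subgroup_def intro!: exI[of _ 0])
    fix x y assume "x \<in> ?S" "y \<in> ?S"
    then obtain m n m' n' where *: "x = m + n" "y = m' + n'" "m \<in> M" "n \<in> N" "m' \<in> M" "n' \<in> N" by blast
    then have "x - y = (m - m') + (n - n')" by simp
    with * assms show "x - y \<in> ?S" unfolding add_subgroup_def by blast
  qed
  moreover have "M \<union> N \<subseteq> ?S"
    using assms unfolding add_subgroup_def by (auto, metis add_0_right, metis add_0_left)
  ultimately show "group_closure (M \<union> N) \<subseteq> ?S" by (intro group_closure_least)
  show "?S \<subseteq> group_closure (M \<union> N)"
    using add_subgroup_group_closure[of "M \<union> N"]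
    by (auto intro!: add_subgroup_add intro: group_closure_incl)
qed

text \<open>Taking \<open>rel\<close> to be \<subset> gives the descending and \<supset> the
  ascending chain condition, so one proof serves both. Well-foundedness makes inverse images and
  lexicographic products available.\<close>

definition chain_condition :: "('a set \<Rightarrow> 'a set \<Rightarrow> bool) \<Rightarrow> 'a set set \<Rightarrow> bool" where
  "chain_condition rel X \<longleftrightarrow> wf {(U, V). U \<in> X \<and> V \<in> X \<and> rel U V}"

lemma gr_artinian_iff:
  "gr_artinian \<Gamma> R A M \<longleftrightarrow> chain_condition (\<subset>) (Collect (graded_submodule \<Gamma> R A M))"
  unfolding gr_artinian_def chain_condition_def wf_iff_no_infinite_down_chain mem_Collect_eq prod.case
  by metis

lemma gr_noetherian_iff:
  "gr_noetherian \<Gamma> R A M \<longleftrightarrow> chain_condition (\<supset>) (Collect (graded_submodule \<Gamma> R A M))"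
  unfolding gr_noetherian_def chain_condition_def wf_iff_no_infinite_down_chain mem_Collect_eq prod.case
  by metis

text \<open>The map sending \<open>U\<close> to \<open>(f U, g U)\<close> is strictly monotone into
  the lexicographic product: if the first coordinate stays the same, the second one must
  move.\<close>

lemma chain_condition_pair:
  assumes rel: "rel \<in> {(\<subset>), (\<supset>)}" and wf: "chain_condition rel Y" "chain_condition rel Z"
    and f: "\<And>U. U \<in> X \<Longrightarrow> f U \<in> Y" and g: "\<And>U. U \<in> X \<Longrightarrow> g U \<in> Z"
    and strict: "\<And>U V. U \<in> X \<Longrightarrow> V \<in> X \<Longrightarrow> U \<subset> V \<Longrightarrow>
      f U \<subseteq> f V \<and> g U \<subseteq> g V \<and> (f U \<noteq> f V \<or> g U \<noteq> g V)"
  shows "chain_condition rel X"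
proof -
  let ?r = "\<lambda>Y. {(U, V). U \<in> Y \<and> V \<in> Y \<and> rel U V}"
  have "wf (inv_image (?r Y <*lex*> ?r Z) (\<lambda>U. (f U, g U)))"
    using wf by (intro wf_inv_image wf_lex_prod) (auto simp: chain_condition_def)
  moreover have "?r X \<subseteq> inv_image (?r Y <*lex*> ?r Z) (\<lambda>U. (f U, g U))"
  proof (clarify, goal_cases)
    case (1 U V)
    have "rel = (\<subset>) \<or> rel = (\<supset>)" using rel by simp
    then have "f U = f V \<or> rel (f U) (f V)" "f U = f V \<Longrightarrow> rel (g U) (g V)"
      using strict[of U V] strict[of V U] 1 by blast+
    then show ?case using 1 f g by auto
  qed
  ultimately show ?thesis unfolding chain_condition_def by (rule wf_subset)
qed

lemma chain_condition_map:
  assumes "rel \<in> {(\<subset>), (\<supset>)}" "chain_condition rel Y"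
    and "\<And>U. U \<in> X \<Longrightarrow> f U \<in> Y"
    and "\<And>U V. U \<in> X \<Longrightarrow> V \<in> X \<Longrightarrow> U \<subset> V \<Longrightarrow> f U \<subset> f V"
  shows "chain_condition rel X"
proof (rule chain_condition_pair[where f = f and g = f, OF assms(1,2,2,3,3)])
  show "f U \<subseteq> f V \<and> f U \<subseteq> f V \<and> (f U \<noteq> f V \<or> f U \<noteq> f V)"
    if "U \<in> X" "V \<in> X" "U \<subset> V" for U V
    using assms(4)[OF that] by (simp add: psubset_eq)
qed

lemma chain_condition_subset: "chain_condition rel Y \<Longrightarrow> X \<subseteq> Y \<Longrightarrow> chain_condition rel X"
  unfolding chain_condition_def by (erule wf_subset) auto

section \<open>Homogeneous components and graded right ideals\<close>

context graded_ring
begin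

text \<open>Composing with the inverse of \<open>g\<close> undoes composition by \<open>g\<close>.
  Through this, left multiplication by a homogeneous element keeps distinct degrees apart.\<close>

lemma Comp_left_cancel:
  assumes "g \<in> Mor \<Gamma>" "h \<in> Mor \<Gamma>" "k \<in> Mor \<Gamma>" "Src \<Gamma> g = Tgt \<Gamma> h" "Src \<Gamma> g = Tgt \<Gamma> k"
    and eq: "Comp \<Gamma> g h = Comp \<Gamma> g k"
  shows "h = k"
proof -
  obtain i where i: "i \<in> Mor \<Gamma>" "Src \<Gamma> i = Tgt \<Gamma> g" "Comp \<Gamma> i g = Src \<Gamma> g"
    using inverse[OF assms(1)] by blast
  have "Comp \<Gamma> i (Comp \<Gamma> g l) = l" if "l \<in> Mor \<Gamma>" "Src \<Gamma> g = Tgt \<Gamma> l" for l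
    using Comp_assoc[OF i(1) assms(1) that(1) i(2) that(2)] that Comp_Tgt[OF that(1)] i(3) by simp
  then show ?thesis using assms by metis
qed

lemma R_map:
  assumes "x \<in> R" "add_subgroup T" "\<And>x y. f (x - y) = f x - f y"
    and "\<And>g a. g \<in> Mor \<Gamma> \<Longrightarrow> a \<in> A g \<Longrightarrow> f a \<in> T"
  shows "f x \<in> T"
  using group_closure_map[of x _ T f] assms unfolding R_eq by blast

section \<open>Projections onto the homogeneous components\<close>

definition other_components :: "'g \<Rightarrow> 'r set" where
  "other_components g = group_closure (\<Union>h\<in>Mor \<Gamma> - {g}. A h)"

lemma other_components_subgroup: "add_subgroup (other_components g)"
  unfolding other_components_def by (rule add_subgroup_group_closure)

text \<open>Writing \<open>z\<close> as a sum of components of degree other than \<open>g\<close>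
  gives a relation between homogeneous elements with \<open>- z\<close> in degree \<open>g\<close>;
  independence forces that term to vanish.\<close>

lemma other_components_Int:
  assumes g: "g \<in> Mor \<Gamma>" and z: "z \<in> A g" "z \<in> other_components g"
  shows "z = 0"
proof -
  obtain F f where F: "finite F" "F \<subseteq> Mor \<Gamma> - {g}" "\<forall>h\<in>F. f h \<in> A h" "z = sum f F"
    using group_closure_Union_decomposition[of z A "Mor \<Gamma> - {g}"] z(2) subgroup
    unfolding other_components_def by blast
  define f' where "f' h = (if h = g then - z else f h)" for h
  have "sum f' F = sum f F" using F(2) by (intro sum.cong) (auto simp: f'_def)
  then have "sum f' (insert g F) = 0" using F by (subst sum.insert) (auto simp: f'_def)
  moreover have "\<forall>h\<in>insert g F. f' h \<in> A h"
    using F z(1) add_subgroup_uminus[OF subgroup[OF g]] unfolding f'_def by auto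
  moreover have "finite (insert g F)" "insert g F \<subseteq> Mor \<Gamma>" using F g by auto
  moreover have "independent_family (Mor \<Gamma>) A" using decomposition by (simp add: direct_sum_def)
  ultimately have "f' g = 0" unfolding independent_family_def by blast
  then show ?thesis by (simp add: f'_def)
qed

text \<open>This is the projection onto \<open>A g\<close> along \<open>other_components g\<close>.
  Describing it by uniqueness, not through a chosen decomposition, makes additivity a matter of
  checking the two memberships.\<close>

definition proj :: "'g \<Rightarrow> 'r \<Rightarrow> 'r" where
  "proj g x = (THE y. y \<in> A g \<and> x - y \<in> other_components g)"

lemma proj_eqI:
  assumes "g \<in> Mor \<Gamma>" "y \<in> A g" "x - y \<in> other_components g"
  shows "proj g x = y"
  unfolding proj_def
proof (rule the_equality)
  fix z assume z: "z \<in> A g \<and> x - z \<in> other_components g"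
  have "(x - y) - (x - z) \<in> other_components g" "z - y \<in> A g"
    using z assms(2,3) other_components_subgroup subgroup[OF assms(1)] unfolding add_subgroup_def by blast+
  then have "z - y = 0" using assms(1) by (intro other_components_Int) auto
  then show "z = y" by simp
qed (use assms in auto)

lemma proj_same: "g \<in> Mor \<Gamma> \<Longrightarrow> a \<in> A g \<Longrightarrow> proj g a = a"
  using other_components_subgroup by (intro proj_eqI) (auto simp: add_subgroup_def)

lemma proj_other: "g \<in> Mor \<Gamma> \<Longrightarrow> h \<in> Mor \<Gamma> \<Longrightarrow> h \<noteq> g \<Longrightarrow> a \<in> A h \<Longrightarrow> proj g a = 0"
  by (intro proj_eqI zero_in) (auto simp: other_components_def intro: group_closure_incl)

lemma proj_spec:
  assumes g: "g \<in> Mor \<Gamma>" and "x \<in> R"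
  shows "proj g x \<in> A g \<and> x - proj g x \<in> other_components g"
  using assms(2) unfolding R_eq
proof induction
  case (base s)
  \<comment> \<open>The extra generator 0 of the closure is treated as a homogeneous element of
    degree \<open>g\<close>.\<close>
  then obtain h where h: "h \<in> Mor \<Gamma>" "s \<in> A h" using g zero_in[OF g] by auto
  then show ?case
    using proj_same[OF g] proj_other[OF g h(1)] zero_in[OF g] other_components_subgroup[of g]
    by (cases "h = g") (auto simp: add_subgroup_def other_components_def intro: group_closure_incl)
next
  case (diff s t)
  have 1: "proj g s - proj g t \<in> A g" using diff subgroup[OF g] by (auto simp: add_subgroup_def)
  have "(s - proj g s) - (t - proj g t) \<in> other_components g"
    using diff other_components_subgroup by (auto simp: add_subgroup_def)
  then have 2: "(s - t) - (proj g s - proj g t) \<in> other_components g" by (simp add: algebra_simps)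
  show ?case using 1 2 proj_eqI[OF g 1 2] by simp
qed

lemma proj_diff:
  assumes g: "g \<in> Mor \<Gamma>" and "x \<in> R" "y \<in> R"
  shows "proj g (x - y) = proj g x - proj g y"
proof (rule proj_eqI[OF g])
  have xy: "proj g x \<in> A g" "x - proj g x \<in> other_components g"
    "proj g y \<in> A g" "y - proj g y \<in> other_components g"
    using proj_spec[OF g] assms by auto
  then show "proj g x - proj g y \<in> A g" using subgroup[OF g] by (auto simp: add_subgroup_def)
  have "(x - proj g x) - (y - proj g y) \<in> other_components g"
    using xy other_components_subgroup by (auto simp: add_subgroup_def)
  then show "x - y - (proj g x - proj g y) \<in> other_components g" by (simp add: algebra_simps)
qed

text \<open>Left multiplication by \<open>a\<close> shifts degree \<open>k\<close> to
  \<open>Comp \<Gamma> h k\<close> or kills it. By cancellation no component of \<open>x\<close>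
  other than the one of degree \<open>g\<close> can land in the target degree.\<close>

lemma proj_mult_left:
  assumes h: "h \<in> Mor \<Gamma>" "a \<in> A h" and g: "g \<in> Mor \<Gamma>" "Src \<Gamma> h = Tgt \<Gamma> g" and "x \<in> R"
  shows "a * proj g x = proj (Comp \<Gamma> h g) (a * x)"
  using assms(5) unfolding R_eq
proof induction
  case (base s)
  then obtain k where k: "k \<in> Mor \<Gamma>" "s \<in> A k" using g zero_in by auto
  have hg: "Comp \<Gamma> h g \<in> Mor \<Gamma>" by (intro Comp_closed h g)
  show ?case
  proof (cases "k = g")
    case True
    then show ?thesis using k h g hg by (simp add: proj_same mult_in)
  next
    case kg: False
    then have 0: "proj g s = 0" using k g by (simp add: proj_other)
    show ?thesis
    proof (cases "Src \<Gamma> h = Tgt \<Gamma> k")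
      case True
      then have "Comp \<Gamma> h k \<noteq> Comp \<Gamma> h g" using Comp_left_cancel kg h k g by metis
      then show ?thesis
        using proj_other[OF hg _ _ mult_in[OF h(1) k(1) True h(2) k(2)]] Comp_closed[OF h(1) k(1) True] 0
        by simp
    next
      case False
      then show ?thesis using mult_zero[OF h(1) k(1) False h(2) k(2)] 0
        by (simp add: proj_same[OF hg] zero_in[OF hg])
    qed
  qed
next
  case (diff s t)
  then have "s \<in> R" "t \<in> R" "a * s \<in> R" "a * t \<in> R"
    using R_mult A_sub_R[OF h] unfolding R_eq by auto
  then show ?case
    using diff proj_diff[OF g(1)] proj_diff[OF Comp_closed[OF h(1) g]] by (simp add: right_diff_distrib)
qed

section \<open>Constructions of graded right ideals\<close>

abbreviation gr_ideal :: "'r set \<Rightarrow> bool" where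
  "gr_ideal \<equiv> graded_right_ideal \<Gamma> R A"

text \<open>Independence is inherited from \<open>R\<close> and one inclusion is automatic, so being
  graded amounts to being generated by homogeneous elements.\<close>

lemma gr_ideal_iff:
  "gr_ideal U \<longleftrightarrow> U \<subseteq> R \<and> add_subgroup U \<and> (\<forall>u\<in>U. \<forall>a\<in>R. u * a \<in> U)
     \<and> U \<subseteq> group_closure (\<Union>g\<in>Mor \<Gamma>. U \<inter> A g)"
proof -
  have "independent_family (Mor \<Gamma>) (\<lambda>g. U \<inter> A g)"
    using decomposition unfolding direct_sum_def by (blast intro: independent_family_mono)
  moreover have "group_closure (\<Union>g\<in>Mor \<Gamma>. U \<inter> A g) \<subseteq> U" if "add_subgroup U"
    using that by (intro group_closure_least) auto
  ultimately show ?thesis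
    unfolding graded_right_ideal_def direct_sum_def subgroup_sum_def by blast
qed

lemma gr_idealD:
  assumes "gr_ideal U"
  shows "U \<subseteq> R" "add_subgroup U" "\<And>u a. u \<in> U \<Longrightarrow> a \<in> R \<Longrightarrow> u * a \<in> U"
    and "U \<subseteq> group_closure (\<Union>g\<in>Mor \<Gamma>. U \<inter> A g)" "0 \<in> U"
  using assms unfolding gr_ideal_iff by (auto simp: add_subgroup_def)

text \<open>For a subgroup, being generated by homogeneous elements is the same as containing the
  components of its elements. This form suits intersections and preimages, where no homogeneous
  generators are at hand.\<close>

lemma gr_ideal_iff_proj:
  "gr_ideal U \<longleftrightarrow> U \<subseteq> R \<and> add_subgroup U \<and> (\<forall>u\<in>U. \<forall>a\<in>R. u * a \<in> U)
     \<and> (\<forall>x\<in>U. \<forall>g\<in>Mor \<Gamma>. proj g x \<in> U)"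
proof -
  have "proj g x \<in> U" if U: "U \<subseteq> R" "add_subgroup U" and g: "g \<in> Mor \<Gamma>"
    and x: "x \<in> group_closure (\<Union>g\<in>Mor \<Gamma>. U \<inter> A g)" for x g
    using x
  proof induction
    case (base s)
    have "0 \<in> U" using U by (simp add: add_subgroup_def)
    with base obtain h where h: "h \<in> Mor \<Gamma>" "s \<in> U" "s \<in> A h" using g zero_in by auto
    then show ?case
      using proj_same[OF g] proj_other[OF g h(1)] \<open>0 \<in> U\<close> by (cases "h = g") auto
  next
    case (diff s t)
    moreover have "group_closure (\<Union>g\<in>Mor \<Gamma>. U \<inter> A g) \<subseteq> U"
      using U by (intro group_closure_least) auto
    ultimately have "s \<in> R" "t \<in> R" using U by auto
    then show ?case using diff U(2) by (auto simp: proj_diff[OF g] add_subgroup_def)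
  qed
  moreover have "x \<in> group_closure (\<Union>g\<in>Mor \<Gamma>. U \<inter> A g)"
    if U: "U \<subseteq> R" "\<forall>x\<in>U. \<forall>g\<in>Mor \<Gamma>. proj g x \<in> U" "x \<in> U" for x
  proof -
    obtain F f where F: "finite F" "F \<subseteq> Mor \<Gamma>" "\<forall>h\<in>F. f h \<in> A h" "x = sum f F"
      using group_closure_Union_decomposition[of x A "Mor \<Gamma>"] U subgroup unfolding R_eq by blast
    \<comment> \<open>Each summand of \<open>x\<close> is a projection of \<open>x\<close>, since
      the remaining summands lie in the complement.\<close>
    have "f g \<in> U \<inter> A g" if "g \<in> F" for g
    proof -
      have "x - f g = sum f (F - {g})" using F that by (simp add: sum.remove[of F g])
      also have "\<dots> \<in> other_components g"
        using F by (intro add_subgroup_sum other_components_subgroup)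
          (auto simp: other_components_def intro!: group_closure_incl)
      finally have "proj g x = f g" using F that by (intro proj_eqI) auto
      moreover have "g \<in> Mor \<Gamma>" "f g \<in> A g" using F that by auto
      ultimately show ?thesis using U(2,3) by (metis IntI)
    qed
    then show ?thesis using F unfolding F(4)
      by (intro add_subgroup_sum add_subgroup_group_closure group_closure_incl) blast
  qed
  ultimately show ?thesis unfolding gr_ideal_iff by blast
qed

lemma gr_ideal_zero: "gr_ideal {0}"
  using R_subgroup unfolding gr_ideal_iff by (auto simp: add_subgroup_def intro: group_closure_zero)

lemma gr_ideal_R: "gr_ideal R"
proof -
  have "(\<Union>g\<in>Mor \<Gamma>. A g) \<subseteq> (\<Union>g\<in>Mor \<Gamma>. R \<inter> A g)" using A_sub_R by blast
  then have "R \<subseteq> group_closure (\<Union>g\<in>Mor \<Gamma>. R \<inter> A g)"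
    using group_closure_mono R_eq by metis
  then show ?thesis
    unfolding gr_ideal_iff using R_subgroup R_mult by auto
qed

lemma gr_ideal_Int: "gr_ideal U \<Longrightarrow> gr_ideal V \<Longrightarrow> gr_ideal (U \<inter> V)"
  unfolding gr_ideal_iff_proj add_subgroup_def by blast

lemma gr_ideal_Union:
  assumes "\<And>U. U \<in> \<U> \<Longrightarrow> gr_ideal U"
  shows "gr_ideal (group_closure (\<Union>\<U>))"
  unfolding gr_ideal_iff
proof (intro conjI add_subgroup_group_closure ballI)
  show "group_closure (\<Union>\<U>) \<subseteq> R"
    using gr_idealD[OF assms] R_subgroup by (intro group_closure_least) auto
  show "x * a \<in> group_closure (\<Union>\<U>)" if "x \<in> group_closure (\<Union>\<U>)" "a \<in> R" for x a
    by (rule group_closure_map[OF that(1) add_subgroup_group_closure])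
      (use gr_idealD(3)[OF assms] that(2) in \<open>auto simp: left_diff_distrib intro!: group_closure_incl\<close>)
  have "U \<subseteq> group_closure (\<Union>g\<in>Mor \<Gamma>. group_closure (\<Union>\<U>) \<inter> A g)" if "U \<in> \<U>" for U
  proof -
    have "U \<subseteq> group_closure (\<Union>g\<in>Mor \<Gamma>. U \<inter> A g)" using gr_idealD(4)[OF assms[OF that]] .
    also have "\<dots> \<subseteq> group_closure (\<Union>g\<in>Mor \<Gamma>. group_closure (\<Union>\<U>) \<inter> A g)"
      using that by (intro group_closure_mono) (auto intro!: group_closure_incl)
    finally show ?thesis .
  qed
  then show "group_closure (\<Union>\<U>) \<subseteq> group_closure (\<Union>g\<in>Mor \<Gamma>. group_closure (\<Union>\<U>) \<inter> A g)"
    by (intro group_closure_least add_subgroup_group_closure) auto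
qed

lemma gr_ideal_Un: "gr_ideal U \<Longrightarrow> gr_ideal V \<Longrightarrow> gr_ideal (group_closure (U \<union> V))"
  using gr_ideal_Union[of "{U, V}"] by auto

text \<open>Left multiplication by \<open>a\<close> commutes with right multiplication by
  \<open>R\<close> and sends homogeneous elements to homogeneous elements or 0.\<close>

lemma gr_ideal_image:
  assumes h: "h \<in> Mor \<Gamma>" "a \<in> A h" and U: "gr_ideal U"
  shows "gr_ideal ((*) a ` U)"
  unfolding gr_ideal_iff
proof (intro conjI ballI)
  note U' = gr_idealD[OF U]
  show "(*) a ` U \<subseteq> R" using U' R_mult A_sub_R[OF h] by auto
  show sg: "add_subgroup ((*) a ` U)"
    using U'(2,5) unfolding add_subgroup_def
    by (auto simp: right_diff_distrib[symmetric]) (metis imageI mult_zero_right)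
  show "x * b \<in> (*) a ` U" if "x \<in> (*) a ` U" "b \<in> R" for x b
    using that U'(3) by (auto simp: mult.assoc)
  show "(*) a ` U \<subseteq> group_closure (\<Union>g\<in>Mor \<Gamma>. (*) a ` U \<inter> A g)"
  proof
    fix y assume "y \<in> (*) a ` U"
    then obtain x where x: "y = a * x" "x \<in> group_closure (\<Union>g\<in>Mor \<Gamma>. U \<inter> A g)" using U'(4) by auto
    show "y \<in> group_closure (\<Union>g\<in>Mor \<Gamma>. (*) a ` U \<inter> A g)"
      unfolding x(1)
    proof (rule group_closure_map[OF x(2) add_subgroup_group_closure])
      fix s assume "s \<in> (\<Union>g\<in>Mor \<Gamma>. U \<inter> A g)"
      then obtain g where g: "g \<in> Mor \<Gamma>" "s \<in> U" "s \<in> A g" by blast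
      show "a * s \<in> group_closure (\<Union>g\<in>Mor \<Gamma>. (*) a ` U \<inter> A g)"
      proof (cases "Src \<Gamma> h = Tgt \<Gamma> g")
        case True
        then show ?thesis
          using mult_in[OF h(1) g(1) True h(2) g(3)] Comp_closed[OF h(1) g(1) True] g(2)
          by (intro group_closure_incl) blast
      next
        case False
        then show ?thesis using mult_zero[OF h(1) g(1) False h(2) g(3)] by (simp add: group_closure_zero)
      qed
    qed (simp add: right_diff_distrib)
  qed
qed

text \<open>For each component of \<open>x\<close>, its product with \<open>a\<close> is either a
  component of \<open>a * x\<close>, hence in \<open>V\<close>, or 0. With
  \<open>gr_ideal_image\<close>, this lets left multiplication by \<open>a\<close> act as a graded
  homomorphism.\<close>

lemma gr_ideal_preimage:
  assumes h: "h \<in> Mor \<Gamma>" "a \<in> A h" and U: "gr_ideal U" and V: "gr_ideal V"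
  shows "gr_ideal {x \<in> U. a * x \<in> V}"
  unfolding gr_ideal_iff_proj
proof (intro conjI ballI)
  note U' = gr_idealD[OF U] and V' = gr_idealD[OF V]
  show "{x \<in> U. a * x \<in> V} \<subseteq> R" using U' by auto
  show "add_subgroup {x \<in> U. a * x \<in> V}"
    using U'(2) V'(2) by (auto simp: add_subgroup_def right_diff_distrib)
  show "x * b \<in> {x \<in> U. a * x \<in> V}" if "x \<in> {x \<in> U. a * x \<in> V}" "b \<in> R" for x b
    using that U'(3) V'(3) by (auto simp: mult.assoc[symmetric])
  show "proj g x \<in> {x \<in> U. a * x \<in> V}" if x: "x \<in> {x \<in> U. a * x \<in> V}" and g: "g \<in> Mor \<Gamma>" for x g
  proof -
    have "x \<in> R" using x U' by auto
    have "a * proj g x \<in> V"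
    proof (cases "Src \<Gamma> h = Tgt \<Gamma> g")
      case True
      then show ?thesis
        using proj_mult_left[OF h g True \<open>x \<in> R\<close>] V x Comp_closed[OF h(1) g True]
        unfolding gr_ideal_iff_proj by auto
    next
      case False
      then show ?thesis
        using mult_zero[OF h(1) g False h(2)] proj_spec[OF g \<open>x \<in> R\<close>] V'(5) by auto
    qed
    then show ?thesis using U x g unfolding gr_ideal_iff_proj by auto
  qed
qed

lemma one_at_R: "e \<in> idents \<Gamma> \<Longrightarrow> one_at A e \<in> R"
  using A_sub_R identsD one_at_in by blast

section \<open>Chain conditions and semisimplicity for graded right ideals\<close>

abbreviation chain_cond :: "('r set \<Rightarrow> 'r set \<Rightarrow> bool) \<Rightarrow> 'r set \<Rightarrow> bool" where
  "chain_cond rel M \<equiv> chain_condition rel (Collect (graded_submodule \<Gamma> R A M))"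

lemma chain_cond_mono: "chain_cond rel N \<Longrightarrow> M \<subseteq> N \<Longrightarrow> chain_cond rel M"
  unfolding graded_submodule_def by (erule chain_condition_subset) blast

lemma chain_cond_zero:
  assumes "rel \<in> {(\<subset>), (\<supset>)}"
  shows "chain_cond rel {0}"
proof -
  have *: "U = {0}" if "graded_submodule \<Gamma> R A {0} U" for U
    using that gr_idealD(5)[of U] unfolding graded_submodule_def by auto
  have "\<not> rel {0} {0}" using assms by auto
  then have "{(U, V). U \<in> Collect (graded_submodule \<Gamma> R A {0}) \<and>
      V \<in> Collect (graded_submodule \<Gamma> R A {0}) \<and> rel U V} \<subseteq> {}"
    using * by blast
  then show ?thesis unfolding chain_condition_def by (rule wf_subset[rotated]) simp
qed

text \<open>By the modular law, a graded submodule \<open>U\<close> of \<open>M + N\<close> can only grow strictly if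
  \<open>U \<inter> M\<close> or \<open>(U + M) \<inter> N\<close> does.\<close>

lemma chain_cond_Un:
  assumes rel: "rel \<in> {(\<subset>), (\<supset>)}" and M: "gr_ideal M" "chain_cond rel M"
    and N: "gr_ideal N" "chain_cond rel N"
  shows "chain_cond rel (group_closure (M \<union> N))"
proof (rule chain_condition_pair[OF rel M(2) N(2)])
  fix U assume "U \<in> Collect (graded_submodule \<Gamma> R A (group_closure (M \<union> N)))"
  then have U: "gr_ideal U" by (simp add: graded_submodule_def)
  show "U \<inter> M \<in> Collect (graded_submodule \<Gamma> R A M)"
    using gr_ideal_Int[OF U M(1)] by (simp add: graded_submodule_def)
  show "group_closure (U \<union> M) \<inter> N \<in> Collect (graded_submodule \<Gamma> R A N)"
    using gr_ideal_Int[OF gr_ideal_Un[OF U M(1)] N(1)] by (simp add: graded_submodule_def)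
  fix V assume "V \<in> Collect (graded_submodule \<Gamma> R A (group_closure (M \<union> N)))" and UV: "U \<subset> V"
  then have V: "gr_ideal V" "V \<subseteq> group_closure (M \<union> N)" by (auto simp: graded_submodule_def)
  note sg = gr_idealD(2)[OF U] gr_idealD(2)[OF V(1)] gr_idealD(2)[OF M(1)] gr_idealD(2)[OF N(1)]
  have "group_closure (U \<union> M) \<subseteq> group_closure (V \<union> M)"
    using UV by (intro group_closure_mono) auto
  moreover have "V \<subseteq> U" if eq: "U \<inter> M = V \<inter> M" "group_closure (U \<union> M) \<inter> N = group_closure (V \<union> M) \<inter> N"
  proof
    fix v assume v: "v \<in> V"
    then obtain m n where mn: "v = m + n" "m \<in> M" "n \<in> N"
      using V(2) group_closure_Un[OF sg(3,4)] by blast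
    \<comment> \<open>Here \<open>n\<close> lies in \<open>V + M\<close> and in \<open>N\<close>, so
      the second equality allows it to be replaced, modulo \<open>M\<close>, by an element of
      \<open>U\<close>.\<close>
    have "n = v - m" using mn by simp
    then have "n \<in> group_closure (V \<union> M)"
      using v mn(2) by (simp add: group_closure.diff group_closure_incl)
    then have "n \<in> group_closure (U \<union> M)" using eq(2) mn(3) by blast
    then obtain u m' where um: "n = u + m'" "u \<in> U" "m' \<in> M"
      unfolding group_closure_Un[OF sg(1,3)] by blast
    have "v - u = m + m'" using mn um by simp
    moreover have "v - u \<in> V" using v um UV sg(2) by (auto simp: add_subgroup_def)
    moreover have "m + m' \<in> M" using mn um sg(3) by (simp add: add_subgroup_add)
    ultimately have "v - u \<in> U" using eq(1) by auto
    then have "(v - u) + u \<in> U" using um sg(1) by (intro add_subgroup_add)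
    then show "v \<in> U" by simp
  qed
  ultimately show "U \<inter> M \<subseteq> V \<inter> M \<and> group_closure (U \<union> M) \<inter> N \<subseteq> group_closure (V \<union> M) \<inter> N \<and>
    (U \<inter> M \<noteq> V \<inter> M \<or> group_closure (U \<union> M) \<inter> N \<noteq> group_closure (V \<union> M) \<inter> N)"
    using UV by blast
qed

text \<open>Taking preimages in \<open>M\<close> is strictly monotone on submodules of the image,
  since each such submodule is the image of its preimage.\<close>

lemma chain_cond_image:
  assumes rel: "rel \<in> {(\<subset>), (\<supset>)}" and a: "g \<in> Mor \<Gamma>" "a \<in> A g"
    and M: "gr_ideal M" "chain_cond rel M"
  shows "chain_cond rel ((*) a ` M)"
  by (rule chain_condition_map[OF rel M(2), where f = "\<lambda>V. {x \<in> M. a * x \<in> V}"])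
    (use gr_ideal_preimage[OF a M(1)] in \<open>auto simp: graded_submodule_def\<close>)

section \<open>Graded simple and semisimple right ideals\<close>

abbreviation simples :: "'r set \<Rightarrow> 'r set set" where
  "simples M \<equiv> {S. graded_submodule \<Gamma> R A M S \<and> gr_simple \<Gamma> R A S}"

lemma gr_semisimple_gr_ideal: "gr_semisimple \<Gamma> R A M \<Longrightarrow> gr_ideal M"
  unfolding gr_semisimple_def subgroup_sum_def graded_submodule_def using gr_ideal_Union by auto

text \<open>The family of all simple submodules can serve as the witness, as its sum never leaves
  \<open>M\<close>.\<close>

lemma gr_semisimple_iff:
  assumes "gr_ideal M"
  shows "gr_semisimple \<Gamma> R A M \<longleftrightarrow> M \<subseteq> group_closure (\<Union>(simples M))"
proof
  assume "gr_semisimple \<Gamma> R A M"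
  then obtain \<S> where \<S>: "\<S> \<subseteq> simples M" "M = group_closure (\<Union>\<S>)"
    unfolding gr_semisimple_def subgroup_sum_def by auto
  then show "M \<subseteq> group_closure (\<Union>(simples M))"
    using group_closure_mono[of "\<Union>\<S>" "\<Union>(simples M)"] by blast
next
  assume *: "M \<subseteq> group_closure (\<Union>(simples M))"
  have "group_closure (\<Union>(simples M)) \<subseteq> M"
    using gr_idealD(2)[OF assms] by (intro group_closure_least) (auto simp: graded_submodule_def)
  with * show "gr_semisimple \<Gamma> R A M"
    unfolding gr_semisimple_def subgroup_sum_def by (intro exI[of _ "simples M"]) auto
qed

lemma simples_mono: "M \<subseteq> N \<Longrightarrow> group_closure (\<Union>(simples M)) \<subseteq> group_closure (\<Union>(simples N))"
  by (intro group_closure_mono) (auto simp: graded_submodule_def)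

lemma gr_semisimple_Union:
  assumes "\<And>M. M \<in> \<M> \<Longrightarrow> gr_semisimple \<Gamma> R A M"
  shows "gr_semisimple \<Gamma> R A (group_closure (\<Union>\<M>))"
proof -
  have "M \<subseteq> group_closure (\<Union>(simples (group_closure (\<Union>\<M>))))" if "M \<in> \<M>" for M
    using assms[OF that] gr_semisimple_iff[OF gr_semisimple_gr_ideal[OF assms[OF that]]]
      simples_mono[of M "group_closure (\<Union>\<M>)"] that by (blast intro: group_closure_incl)
  then have "group_closure (\<Union>\<M>) \<subseteq> group_closure (\<Union>(simples (group_closure (\<Union>\<M>))))"
    by (intro group_closure_least add_subgroup_group_closure Union_least)
  then show ?thesis
    using gr_semisimple_iff[OF gr_ideal_Union] gr_semisimple_gr_ideal[OF assms] by blast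
qed

text \<open>The argument of Schur's lemma: the preimage in \<open>S\<close> of a submodule of the
  image is 0 or all of \<open>S\<close>.\<close>

lemma gr_simple_image:
  assumes a: "g \<in> Mor \<Gamma>" "a \<in> A g" and S: "gr_ideal S" "gr_simple \<Gamma> R A S" and nz: "(*) a ` S \<noteq> {0}"
  shows "gr_simple \<Gamma> R A ((*) a ` S)"
  unfolding gr_simple_def
proof (intro conjI nz allI impI)
  fix V assume "graded_submodule \<Gamma> R A ((*) a ` S) V"
  then have V: "gr_ideal V" "V \<subseteq> (*) a ` S" by (auto simp: graded_submodule_def)
  have "graded_submodule \<Gamma> R A S {x \<in> S. a * x \<in> V}"
    using gr_ideal_preimage[OF a S(1) V(1)] by (auto simp: graded_submodule_def)
  then consider "{x \<in> S. a * x \<in> V} = {0}" | "{x \<in> S. a * x \<in> V} = S"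
    using S(2) unfolding gr_simple_def by blast
  then show "V = {0} \<or> V = (*) a ` S"
  proof cases
    case 1
    have "v = 0" if v: "v \<in> V" for v
    proof -
      obtain x where x: "v = a * x" "x \<in> S" using v V(2) by blast
      then have "x \<in> {0}" unfolding 1[symmetric] using v by simp
      then show ?thesis using x by simp
    qed
    then show ?thesis using gr_idealD(5)[OF V(1)] by auto
  next
    case 2
    then show ?thesis using V(2) by blast
  qed
qed

text \<open>Each simple summand is sent to 0 or to a simple submodule of the image.\<close>

lemma gr_semisimple_image:
  assumes a: "g \<in> Mor \<Gamma>" "a \<in> A g" and M: "gr_semisimple \<Gamma> R A M"
  shows "gr_semisimple \<Gamma> R A ((*) a ` M)"
proof -
  note M' = gr_semisimple_gr_ideal[OF M]
  have "a * x \<in> group_closure (\<Union>(simples ((*) a ` M)))" if "x \<in> M" for x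
  proof -
    have "x \<in> group_closure (\<Union>(simples M))" using that M gr_semisimple_iff[OF M'] by blast
    then show ?thesis
    proof (rule group_closure_map[OF _ add_subgroup_group_closure])
      fix s assume "s \<in> \<Union>(simples M)"
      then obtain S where S: "s \<in> S" "gr_ideal S" "S \<subseteq> M" "gr_simple \<Gamma> R A S"
        by (auto simp: graded_submodule_def)
      show "a * s \<in> group_closure (\<Union>(simples ((*) a ` M)))"
      proof (cases "(*) a ` S = {0}")
        case True
        then have "a * s = 0" using S(1) by blast
        then show ?thesis by (simp add: group_closure_zero)
      next
        case False
        then have "(*) a ` S \<in> simples ((*) a ` M)"
          using gr_ideal_image[OF a S(2)] gr_simple_image[OF a S(2,4)] S(3)
          by (auto simp: graded_submodule_def)
        then show ?thesis using S(1) by (intro group_closure_incl) blast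
      qed
    qed (simp add: right_diff_distrib)
  qed
  then show ?thesis by (subst gr_semisimple_iff[OF gr_ideal_image[OF a M']]) auto
qed

end

section \<open>Comparison with the corner ring\<close>

locale d_generated_ring = graded_ring \<Gamma> R A
  for \<Gamma> :: "'g arrows" and R :: "'r::ring set" and A :: "'g \<Rightarrow> 'r set" +
  fixes \<Delta> :: "'g set"
  assumes d_generating: "d_generating \<Gamma> R A \<Delta>"
begin

section \<open>Generation of the ring from the objects in \<Delta>\<close>

lemma \<Delta>: "finite \<Delta>" "\<Delta> \<subseteq> idents \<Gamma>"
  using d_generating by (auto simp: d_generating_def)

lemma R_generated: "R = group_closure {a * one_at A e * b | a b e. e \<in> \<Delta> \<and> a \<in> R \<and> b \<in> R}" (is "R = group_closure ?S")
proof
  have "R = group_closure (\<Union>e\<in>\<Delta>. group_closure {a * one_at A e * b | a b. a \<in> R \<and> b \<in> R})"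
    using d_generating by (simp add: d_generating_def subgroup_sum_def one_ideal_def[abs_def])
  also have "\<dots> \<subseteq> group_closure ?S"
    by (intro group_closure_least add_subgroup_group_closure UN_least group_closure_mono) auto
  finally show "R \<subseteq> group_closure ?S" .
  show "group_closure ?S \<subseteq> R"
    using \<Delta> one_at_R by (intro group_closure_least R_subgroup) (auto intro!: R_mult)
qed

text \<open>In a generator \<open>a * one_at A e * b\<close> the last two factors form an element of
  R(e), and additivity reduces \<open>a\<close> to homogeneous elements. Homogeneity of
  \<open>a\<close> is what makes the image of R(e) graded.\<close>

lemma R_generated_induct:
  assumes x: "x \<in> R" and T: "add_subgroup T"
    and *: "\<And>g a e y. g \<in> Mor \<Gamma> \<Longrightarrow> a \<in> A g \<Longrightarrow> e \<in> \<Delta> \<Longrightarrow> y \<in> right_piece R A e \<Longrightarrow> a * y \<in> T"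
  shows "x \<in> T"
proof (rule group_closure_map[where f = "\<lambda>x. x", OF _ T])
  show "x \<in> group_closure {a * one_at A e * b | a b e. e \<in> \<Delta> \<and> a \<in> R \<and> b \<in> R}"
    using x R_generated by simp
  fix s assume "s \<in> {a * one_at A e * b | a b e. e \<in> \<Delta> \<and> a \<in> R \<and> b \<in> R}"
  then obtain a b e where s: "s = a * (one_at A e * b)" "e \<in> \<Delta>" "a \<in> R" "b \<in> R"
    by (auto simp: mult.assoc)
  then have "one_at A e * b \<in> right_piece R A e" by (auto simp: right_piece_def)
  then show "s \<in> T" unfolding s(1)
    using s(2) * by (intro R_map[OF s(3) T, where f = "\<lambda>a. a * (one_at A e * b)"]) (auto simp: left_diff_distrib)
qed simp

text \<open>The elements lying in some graded right ideal with the chain condition form a subgroup,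
  because sums of two such ideals qualify again; this replaces an explicit finite sum. As
  \<open>x\<close> is arbitrary, \<open>{x * a | a. a \<in> R}\<close> need not be graded itself,
  but it lies in such an ideal.\<close>

lemma chain_cond_principal:
  assumes rel: "rel \<in> {(\<subset>), (\<supset>)}" and *: "\<And>e. e \<in> \<Delta> \<Longrightarrow> chain_cond rel (right_piece R A e)"
    and "x \<in> R"
  shows "chain_cond rel {x * a | a. a \<in> R}"
proof -
  let ?T = "{x. \<exists>M. gr_ideal M \<and> x \<in> M \<and> chain_cond rel M}"
  have "x \<in> ?T"
  proof (rule R_generated_induct[OF assms(3)])
    show "add_subgroup ?T"
      unfolding add_subgroup_def
    proof (intro conjI ballI)
      show "0 \<in> ?T" using gr_ideal_zero chain_cond_zero[OF rel] by blast
      fix x y assume "x \<in> ?T" "y \<in> ?T"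
      then obtain M N where M: "gr_ideal M" "x \<in> M" "chain_cond rel M"
        and N: "gr_ideal N" "y \<in> N" "chain_cond rel N" by blast
      have "x - y \<in> group_closure (M \<union> N)" using M N by (simp add: group_closure.diff group_closure_incl)
      then show "x - y \<in> ?T"
        using gr_ideal_Un[OF M(1) N(1)] chain_cond_Un[OF rel M(1,3) N(1,3)] by blast
    qed
    fix g a e y assume a: "g \<in> Mor \<Gamma>" "a \<in> A g" and e: "e \<in> \<Delta>" and y: "y \<in> right_piece R A e"
    have M: "gr_ideal (right_piece R A e)" using e \<Delta> graded_right_ideal_right_piece by auto
    show "a * y \<in> ?T"
      using gr_ideal_image[OF a M] chain_cond_image[OF rel a M *[OF e]] y by blast
  qed
  then obtain M where M: "gr_ideal M" "x \<in> M" "chain_cond rel M" by blast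
  then show ?thesis using gr_idealD(3)[OF M(1)] by (intro chain_cond_mono[OF M(3)]) auto
qed

text \<open>R(e) is the image of \<open>R\<close> under left multiplication by
  \<open>one_at A e\<close>; conversely \<open>R\<close> is generated by homogeneous left multiples
  of the R(e) with \<open>e\<close> in \<Delta>.\<close>

lemma gr_semisimple_ring_iff:
  "gr_semisimple \<Gamma> R A R \<longleftrightarrow> (\<forall>e\<in>\<Delta>. gr_semisimple \<Gamma> R A (right_piece R A e))"
proof
  assume R: "gr_semisimple \<Gamma> R A R"
  show "\<forall>e\<in>\<Delta>. gr_semisimple \<Gamma> R A (right_piece R A e)"
  proof
    fix e assume "e \<in> \<Delta>"
    then have "e \<in> Mor \<Gamma>" "one_at A e \<in> A e" using \<Delta> identsD one_at_in by auto
    then have "gr_semisimple \<Gamma> R A ((*) (one_at A e) ` R)" by (intro gr_semisimple_image R)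
    also have "(*) (one_at A e) ` R = right_piece R A e" by (auto simp: right_piece_def)
    finally show "gr_semisimple \<Gamma> R A (right_piece R A e)" .
  qed
next
  assume *: "\<forall>e\<in>\<Delta>. gr_semisimple \<Gamma> R A (right_piece R A e)"
  have "x \<in> group_closure (\<Union>(simples R))" if "x \<in> R" for x
  proof (rule R_generated_induct[OF that add_subgroup_group_closure])
    fix g a e y assume a: "g \<in> Mor \<Gamma>" "a \<in> A g" and e: "e \<in> \<Delta>" and y: "y \<in> right_piece R A e"
    have M: "gr_semisimple \<Gamma> R A ((*) a ` right_piece R A e)" using gr_semisimple_image[OF a] * e by blast
    then have I: "gr_ideal ((*) a ` right_piece R A e)" by (rule gr_semisimple_gr_ideal)
    have "a * y \<in> group_closure (\<Union>(simples ((*) a ` right_piece R A e)))"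
      using M y unfolding gr_semisimple_iff[OF I] by blast
    also have "\<dots> \<subseteq> group_closure (\<Union>(simples R))" using gr_idealD(1)[OF I] by (rule simples_mono)
    finally show "a * y \<in> group_closure (\<Union>(simples R))" .
  qed
  then show "gr_semisimple \<Gamma> R A R" by (subst gr_semisimple_iff[OF gr_ideal_R]) auto
qed

section \<open>The idempotent of \<Delta> and the corner ring\<close>

definition unit :: 'r where
  "unit = (\<Sum>e\<in>\<Delta>. one_at A e)"

lemma unit_R: "unit \<in> R"
  unfolding unit_def using \<Delta> one_at_R by (intro add_subgroup_sum R_subgroup) auto

lemma unit_left: "g \<in> Mor \<Gamma> \<Longrightarrow> a \<in> A g \<Longrightarrow> unit * a = (if Tgt \<Gamma> g \<in> \<Delta> then a else 0)"
proof -
  assume a: "g \<in> Mor \<Gamma>" "a \<in> A g"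
  have "unit * a = (\<Sum>e\<in>\<Delta>. if Tgt \<Gamma> g = e then a else 0)"
    unfolding unit_def sum_distrib_right using a \<Delta> by (intro sum.cong) (auto simp: one_at_left)
  then show ?thesis using \<Delta> by simp
qed

lemma unit_right: "g \<in> Mor \<Gamma> \<Longrightarrow> a \<in> A g \<Longrightarrow> a * unit = (if Src \<Gamma> g \<in> \<Delta> then a else 0)"
proof -
  assume a: "g \<in> Mor \<Gamma>" "a \<in> A g"
  have "a * unit = (\<Sum>e\<in>\<Delta>. if Src \<Gamma> g = e then a else 0)"
    unfolding unit_def sum_distrib_left using a \<Delta> by (intro sum.cong) (auto simp: one_at_right)
  then show ?thesis using \<Delta> by simp
qed

lemma unit_one_at:
  assumes "e \<in> \<Delta>"
  shows "unit * one_at A e = one_at A e" "one_at A e * unit = one_at A e"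
  using assms \<Delta> identsD[of e] one_at_in[of e] unit_left[of e] unit_right[of e] by auto

lemma unit_unit: "unit * unit = unit"
  \<comment> \<open>Expanding only the right factor and the right-hand side leaves the termwise
    identity \<open>unit * one_at A e = one_at A e\<close>.\<close>
  by (subst (2 3) unit_def) (simp add: sum_distrib_left unit_one_at cong: sum.cong)

abbreviation corner :: "'r set" where "corner \<equiv> corner_ring R A \<Delta>"

sublocale corner: graded_ring \<Gamma> corner "corner_grading \<Gamma> A \<Delta>"
  by (rule graded_ring_corner[OF \<Delta>(2)])

lemma unit_mult_in_corner:
  assumes "x \<in> R"
  shows "unit * x * unit \<in> corner"
proof (rule R_map[OF assms corner.R_subgroup])
  fix g a assume a: "g \<in> Mor \<Gamma>" "a \<in> A g"
  then have "unit * a * unit = (if Tgt \<Gamma> g \<in> \<Delta> \<and> Src \<Gamma> g \<in> \<Delta> then a else 0)"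
    by (simp add: unit_left unit_right)
  then have "unit * a * unit \<in> corner_grading \<Gamma> A \<Delta> g"
    using a zero_in by (simp add: corner_grading_def)
  then show "unit * a * unit \<in> corner" using a(1) corner.A_sub_R by blast
qed (simp add: algebra_simps)

text \<open>Identifies the corner ring with \<open>u R u\<close> for \<open>u = unit\<close>, so
  that membership becomes two equations: an element fixed on both sides equals
  \<open>unit * x * unit\<close>.\<close>

lemma corner_eq: "corner = {x \<in> R. unit * x = x \<and> x * unit = x}" (is "_ = ?S")
proof
  have "add_subgroup ?S"
    using R_subgroup by (auto simp: add_subgroup_def left_diff_distrib right_diff_distrib)
  moreover have "one_at A e * a * one_at A e' \<in> ?S" if "e \<in> \<Delta>" "e' \<in> \<Delta>" "a \<in> R" for e e' a
  proof -
    have "unit * (one_at A e * a * one_at A e') = unit * one_at A e * a * one_at A e'"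
      "one_at A e * a * one_at A e' * unit = one_at A e * a * (one_at A e' * unit)"
      by (simp_all only: mult.assoc)
    moreover have "one_at A e \<in> R" "one_at A e' \<in> R" using that \<Delta> one_at_R by auto
    ultimately show ?thesis using that by (simp add: unit_one_at R_mult)
  qed
  ultimately show "corner \<subseteq> ?S"
    unfolding corner_ring_def subgroup_sum_def by (intro group_closure_least) auto
  show "?S \<subseteq> corner" using unit_mult_in_corner by force
qed

text \<open>Gradedness over the corner may be tested against \<open>A\<close>: a homogeneous element
  of the corner with source or target outside \<Delta> is both fixed and killed by
  \<open>unit\<close> on one side, hence 0.\<close>

lemma corner_ideal_iff:
  "corner.gr_ideal V \<longleftrightarrow> V \<subseteq> corner \<and> add_subgroup V \<and> (\<forall>v\<in>V. \<forall>a\<in>corner. v * a \<in> V)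
     \<and> V \<subseteq> group_closure (\<Union>g\<in>Mor \<Gamma>. V \<inter> A g)"
proof -
  have "V \<inter> corner_grading \<Gamma> A \<Delta> g = V \<inter> A g" if V: "V \<subseteq> corner" "add_subgroup V" and g: "g \<in> Mor \<Gamma>" for g
  proof -
    have "v = 0" if "v \<in> V" "v \<in> A g" "\<not> (Tgt \<Gamma> g \<in> \<Delta> \<and> Src \<Gamma> g \<in> \<Delta>)" for v
    proof -
      have "unit * v = v" "v * unit = v" using V(1) that(1) corner_eq by auto
      then show ?thesis using unit_left[OF g that(2)] unit_right[OF g that(2)] that(3) by auto
    qed
    then show ?thesis using V(2) zero_in[OF g] by (auto simp: corner_grading_def add_subgroup_def)
  qed
  then have "V \<subseteq> corner \<Longrightarrow> add_subgroup V \<Longrightarrow>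
      (\<Union>g\<in>Mor \<Gamma>. V \<inter> corner_grading \<Gamma> A \<Delta> g) = (\<Union>g\<in>Mor \<Gamma>. V \<inter> A g)" by simp
  then show ?thesis unfolding corner.gr_ideal_iff by auto
qed

text \<open>The right ideal \<open>u R\<close>, the sum of the R(e) with \<open>e\<close> in
  \<Delta>. It mediates between the corner ring and the single modules R(e).\<close>

definition \<Delta>_part :: "'r set" where
  "\<Delta>_part = {x \<in> R. unit * x = x}"

lemma \<Delta>_part_alt: "\<Delta>_part = {unit * a | a. a \<in> R}"
  unfolding \<Delta>_part_def using R_mult[OF unit_R] unit_unit
  by (auto simp: mult.assoc[symmetric]) metis

lemma right_piece_subset_\<Delta>_part: "e \<in> \<Delta> \<Longrightarrow> right_piece R A e \<subseteq> \<Delta>_part"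
  using \<Delta> one_at_R[of e] unit_one_at(1)[of e] unfolding \<Delta>_part_def right_piece_def
  by (auto simp: mult.assoc[symmetric] R_mult)

lemma \<Delta>_part_eq: "\<Delta>_part = group_closure (\<Union>e\<in>\<Delta>. right_piece R A e)"
proof
  have "unit * a \<in> group_closure (\<Union>e\<in>\<Delta>. right_piece R A e)" if "a \<in> R" for a
    unfolding unit_def sum_distrib_right using that
    by (intro add_subgroup_sum add_subgroup_group_closure group_closure_incl) (auto simp: right_piece_def)
  then show "\<Delta>_part \<subseteq> group_closure (\<Union>e\<in>\<Delta>. right_piece R A e)" unfolding \<Delta>_part_alt by blast
  have "add_subgroup \<Delta>_part"
    using R_subgroup by (auto simp: add_subgroup_def \<Delta>_part_def right_diff_distrib)
  then show "group_closure (\<Union>e\<in>\<Delta>. right_piece R A e) \<subseteq> \<Delta>_part"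
    using right_piece_subset_\<Delta>_part by (intro group_closure_least) auto
qed

lemma gr_ideal_\<Delta>_part: "gr_ideal \<Delta>_part"
  unfolding \<Delta>_part_eq using \<Delta> by (intro gr_ideal_Union) (auto intro: graded_right_ideal_right_piece)

section \<open>Correspondence between graded right ideals in \<open>u R\<close> and in the corner
  ring\<close>

definition restrict :: "'r set \<Rightarrow> 'r set" where
  "restrict U = {x \<in> U. x * unit = x}"

text \<open>The right ideal \<open>V R\<close>, inverse to \<open>restrict\<close>, which is
  \<open>U u\<close> written as fixed points of right multiplication by \<open>unit\<close>.\<close>

definition extend :: "'r set \<Rightarrow> 'r set" where
  "extend V = group_closure {v * r | v r. v \<in> V \<and> r \<in> R}"

lemma restrict_mono: "U \<subseteq> U' \<Longrightarrow> restrict U \<subseteq> restrict U'"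
  by (auto simp: restrict_def)

lemma extend_mono: "V \<subseteq> V' \<Longrightarrow> extend V \<subseteq> extend V'"
  unfolding extend_def by (rule group_closure_mono) auto

lemma restrict_zero: "restrict {0} = {0}"
  by (auto simp: restrict_def)

lemma extend_zero: "extend {0} = {0}"
  using group_closure_least[of "{v * r | v r. v \<in> {0} \<and> r \<in> R}" "{0}"]
  by (auto simp: extend_def add_subgroup_def group_closure_zero)

lemma unit_mult_in_restrict: "gr_ideal U \<Longrightarrow> x \<in> U \<Longrightarrow> x * unit \<in> restrict U"
  using gr_idealD(3)[OF _ _ unit_R] by (auto simp: restrict_def mult.assoc unit_unit)

text \<open>Right multiplication by \<open>unit\<close> fixes or kills a homogeneous element, so it
  turns a homogeneous decomposition of \<open>x = x * unit\<close> in \<open>U\<close> into one in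
  \<open>restrict U\<close>.\<close>

lemma restrict_ideal:
  assumes U: "gr_ideal U" "U \<subseteq> \<Delta>_part"
  shows "corner.gr_ideal (restrict U)"
  unfolding corner_ideal_iff
proof (intro conjI ballI)
  note U' = gr_idealD[OF U(1)]
  show "restrict U \<subseteq> corner"
    using U(2) by (auto simp: corner_eq restrict_def \<Delta>_part_def)
  show "add_subgroup (restrict U)"
    using U'(2) by (auto simp: add_subgroup_def restrict_def left_diff_distrib)
  show "v * a \<in> restrict U" if "v \<in> restrict U" "a \<in> corner" for v a
    using that U'(3) by (auto simp: restrict_def corner_eq mult.assoc)
  show "restrict U \<subseteq> group_closure (\<Union>g\<in>Mor \<Gamma>. restrict U \<inter> A g)"
  proof
    fix x assume "x \<in> restrict U"
    then have x: "x \<in> group_closure (\<Union>g\<in>Mor \<Gamma>. U \<inter> A g)" "x * unit = x"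
      using U'(4) by (auto simp: restrict_def)
    have "x * unit \<in> group_closure (\<Union>g\<in>Mor \<Gamma>. restrict U \<inter> A g)"
    proof (rule group_closure_map[OF x(1) add_subgroup_group_closure])
      fix s assume "s \<in> (\<Union>g\<in>Mor \<Gamma>. U \<inter> A g)"
      then obtain g where g: "g \<in> Mor \<Gamma>" "s \<in> U" "s \<in> A g" by blast
      then have "s * unit \<in> A g" using zero_in by (simp add: unit_right)
      then show "s * unit \<in> group_closure (\<Union>g\<in>Mor \<Gamma>. restrict U \<inter> A g)"
        using g unit_mult_in_restrict[OF U(1)] by (intro group_closure_incl) blast
    qed (simp add: left_diff_distrib)
    then show "x \<in> group_closure (\<Union>g\<in>Mor \<Gamma>. restrict U \<inter> A g)" using x(2) by simp
  qed
qed

text \<open>\<open>V R\<close> is generated by products of homogeneous elements of \<open>V\<close>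
  and of \<open>R\<close>, which are homogeneous or 0.\<close>

lemma extend_ideal:
  assumes V: "corner.gr_ideal V"
  shows "gr_ideal (extend V)" "extend V \<subseteq> \<Delta>_part"
proof -
  note V' = corner.gr_idealD(1,2)[OF V]
  have VR: "V \<subseteq> R" and unitV: "\<And>v. v \<in> V \<Longrightarrow> unit * v = v" using V'(1) corner_eq by auto
  show "extend V \<subseteq> \<Delta>_part" unfolding extend_def
    using VR unitV R_mult
    by (intro group_closure_least gr_idealD(2)[OF gr_ideal_\<Delta>_part])
      (auto simp: \<Delta>_part_def mult.assoc[symmetric])
  show "gr_ideal (extend V)"
    unfolding gr_ideal_iff
  proof (intro conjI ballI)
    show "extend V \<subseteq> R" using \<open>extend V \<subseteq> \<Delta>_part\<close> by (auto simp: \<Delta>_part_def)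
    show "add_subgroup (extend V)" unfolding extend_def by (rule add_subgroup_group_closure)
    show "x * a \<in> extend V" if "x \<in> extend V" "a \<in> R" for x a
      unfolding extend_def
    proof (rule group_closure_map[OF that(1)[unfolded extend_def] add_subgroup_group_closure])
      fix s assume "s \<in> {v * r | v r. v \<in> V \<and> r \<in> R}"
      then obtain v r where "s = v * r" "v \<in> V" "r \<in> R" by blast
      then have "s * a = v * (r * a)" "r * a \<in> R" using that(2) R_mult by (auto simp: mult.assoc)
      then show "s * a \<in> group_closure {v * r | v r. v \<in> V \<and> r \<in> R}"
        using \<open>v \<in> V\<close> by (intro group_closure_incl) blast
    qed (simp add: left_diff_distrib)
    let ?G = "group_closure (\<Union>g\<in>Mor \<Gamma>. extend V \<inter> A g)"
    have "v * r \<in> ?G" if v: "v \<in> V" and r: "r \<in> R" for v r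
    proof -
      have "v \<in> group_closure (\<Union>g\<in>Mor \<Gamma>. V \<inter> A g)" using v V corner_ideal_iff by blast
      then show ?thesis
      proof (rule group_closure_map[OF _ add_subgroup_group_closure, where f = "\<lambda>v. v * r"])
        fix s assume "s \<in> (\<Union>g\<in>Mor \<Gamma>. V \<inter> A g)"
        then obtain g where g: "g \<in> Mor \<Gamma>" "s \<in> V" "s \<in> A g" by blast
        show "s * r \<in> ?G"
        proof (rule R_map[OF r add_subgroup_group_closure])
          fix h a assume h: "h \<in> Mor \<Gamma>" "a \<in> A h"
          show "s * a \<in> ?G"
          proof (cases "Src \<Gamma> g = Tgt \<Gamma> h")
            case True
            have "s * a \<in> extend V"
              unfolding extend_def using g(2) A_sub_R[OF h] by (intro group_closure_incl) blast
            then show ?thesis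
              using mult_in[OF g(1) h(1) True g(3) h(2)] Comp_closed[OF g(1) h(1) True]
              by (intro group_closure_incl) blast
          next
            case False
            then show ?thesis using mult_zero[OF g(1) h(1) False g(3) h(2)] by (simp add: group_closure_zero)
          qed
        qed (simp add: right_diff_distrib)
      qed (simp add: left_diff_distrib)
    qed
    then show "extend V \<subseteq> ?G"
      by (subst (1) extend_def, intro group_closure_least add_subgroup_group_closure) auto
  qed
qed

text \<open>Since \<open>v = v * unit\<close> on \<open>V\<close>, the product \<open>V R u\<close>
  equals \<open>V (u R u)\<close>, which stays in \<open>V\<close>.\<close>

lemma restrict_extend:
  assumes V: "corner.gr_ideal V"
  shows "restrict (extend V) = V"
proof
  note V' = corner.gr_idealD[OF V]
  have unitV: "\<And>v. v \<in> V \<Longrightarrow> v * unit = v" using V'(1) corner_eq by auto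
  show "restrict (extend V) \<subseteq> V"
  proof
    fix x assume "x \<in> restrict (extend V)"
    then have x: "x \<in> group_closure {v * r | v r. v \<in> V \<and> r \<in> R}" "x * unit = x"
      by (auto simp: restrict_def extend_def)
    have "x * unit \<in> V"
    proof (rule group_closure_map[OF x(1) V'(2)])
      fix s assume "s \<in> {v * r | v r. v \<in> V \<and> r \<in> R}"
      then obtain v r where s: "s = v * r" "v \<in> V" "r \<in> R" by blast
      have "s * unit = v * unit * r * unit" using unitV[OF s(2)] s(1) by simp
      also have "\<dots> = v * (unit * r * unit)" by (simp add: mult.assoc)
      also have "\<dots> \<in> V" using V'(3)[OF s(2) unit_mult_in_corner[OF s(3)]] .
      finally show "s * unit \<in> V" .
    qed (simp add: left_diff_distrib)
    then show "x \<in> V" using x(2) by simp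
  qed
  have "v \<in> extend V" if "v \<in> V" for v
    unfolding extend_def using that unitV[OF that] unit_R by (intro group_closure_incl) force
  then show "V \<subseteq> restrict (extend V)" using unitV by (auto simp: restrict_def)
qed

text \<open>Here the generation of \<open>R\<close> by \<Delta> is decisive: for \<open>x\<close> in
  \<open>U\<close>, the product \<open>x * a * one_at A e * b\<close> has its part before
  \<open>b\<close> in \<open>restrict U\<close>, so \<open>U R\<close> lies in
  \<open>extend (restrict U)\<close>.\<close>

lemma extend_restrict:
  assumes U: "gr_ideal U" "U \<subseteq> \<Delta>_part"
  shows "extend (restrict U) = U"
proof
  note U' = gr_idealD[OF U(1)]
  show "extend (restrict U) \<subseteq> U"
    unfolding extend_def using U'(2,3) by (intro group_closure_least) (auto simp: restrict_def)
  have mult: "x * r \<in> extend (restrict U)" if x: "x \<in> U" and r: "r \<in> R" for x r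
    unfolding extend_def
  proof (rule group_closure_map[where f = "\<lambda>r. x * r", OF _ add_subgroup_group_closure])
    show "r \<in> group_closure {a * one_at A e * b | a b e. e \<in> \<Delta> \<and> a \<in> R \<and> b \<in> R}"
      using r R_generated by simp
    fix s assume "s \<in> {a * one_at A e * b | a b e. e \<in> \<Delta> \<and> a \<in> R \<and> b \<in> R}"
    then obtain a b e where s: "s = a * one_at A e * b" "e \<in> \<Delta>" "a \<in> R" "b \<in> R" by blast
    have "x * (a * one_at A e) \<in> restrict U"
      using s x U'(3) unit_one_at(2)[OF s(2)] one_at_R[of e] \<Delta>
      by (auto simp: restrict_def mult.assoc R_mult)
    moreover have "x * s = x * (a * one_at A e) * b" using s by (simp add: mult.assoc)
    ultimately show "x * s \<in> group_closure {v * r | v r. v \<in> restrict U \<and> r \<in> R}"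
      using s(4) by (intro group_closure_incl) blast
  qed (simp add: right_diff_distrib)
  \<comment> \<open>As \<open>R\<close> need not have a unit, \<open>U\<close> is placed inside
    \<open>U R\<close> one component at a time, each homogeneous \<open>x\<close> being fixed by the
    identity at its source.\<close>
  have "x \<in> extend (restrict U)" if "x \<in> U \<inter> A g" "g \<in> Mor \<Gamma>" for x g
    using mult[of x "one_at A (Src \<Gamma> g)"] that one_at_right[OF idents_Src[OF that(2)] that(2), of x]
      one_at_R[OF idents_Src[OF that(2)]] by auto
  then have "group_closure (\<Union>g\<in>Mor \<Gamma>. U \<inter> A g) \<subseteq> extend (restrict U)"
    by (intro group_closure_least) (auto simp: extend_def intro: add_subgroup_group_closure)
  then show "U \<subseteq> extend (restrict U)" using U'(4) by simp
qed

section \<open>Transfer of chain conditions and semisimplicity\<close>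

lemma restrict_\<Delta>_part: "restrict \<Delta>_part = corner"
  by (auto simp: corner_eq \<Delta>_part_def restrict_def)

text \<open>Both \<open>restrict\<close> and \<open>extend\<close> are monotone and injective, hence
  strictly monotone, so \<open>u R\<close> and the corner satisfy the same chain conditions. Those
  of \<open>u R\<close> follow from those of the R(e) as it is the principal right ideal of
  \<open>unit\<close>.\<close>

lemma chain_cond_corner_iff:
  assumes rel: "rel \<in> {(\<subset>), (\<supset>)}"
  shows "corner.chain_cond rel corner \<longleftrightarrow> (\<forall>e\<in>\<Delta>. chain_cond rel (right_piece R A e))"
proof
  assume C: "corner.chain_cond rel corner"
  have "chain_cond rel \<Delta>_part"
  proof (rule chain_condition_map[OF rel C])
    fix U assume "U \<in> Collect (graded_submodule \<Gamma> R A \<Delta>_part)"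
    then have U: "gr_ideal U" "U \<subseteq> \<Delta>_part" by (auto simp: graded_submodule_def)
    then show "restrict U \<in> Collect (graded_submodule \<Gamma> corner (corner_grading \<Gamma> A \<Delta>) corner)"
      using restrict_ideal[OF U] corner.gr_idealD(1) by (auto simp: graded_submodule_def)
    fix V assume "V \<in> Collect (graded_submodule \<Gamma> R A \<Delta>_part)" and UV: "U \<subset> V"
    then have "extend (restrict V) = V" by (auto simp: graded_submodule_def extend_restrict)
    then show "restrict U \<subset> restrict V"
      using UV extend_restrict[OF U] restrict_mono[of U V] by (metis psubset_eq)
  qed
  then show "\<forall>e\<in>\<Delta>. chain_cond rel (right_piece R A e)"
    using chain_cond_mono[OF _ right_piece_subset_\<Delta>_part] by blast
next
  assume "\<forall>e\<in>\<Delta>. chain_cond rel (right_piece R A e)"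
  then have P: "chain_cond rel \<Delta>_part"
    unfolding \<Delta>_part_alt by (intro chain_cond_principal[OF rel _ unit_R]) auto
  show "corner.chain_cond rel corner"
  proof (rule chain_condition_map[OF rel P])
    fix U assume "U \<in> Collect (graded_submodule \<Gamma> corner (corner_grading \<Gamma> A \<Delta>) corner)"
    then have U: "corner.gr_ideal U" by (auto simp: graded_submodule_def)
    show "extend U \<in> Collect (graded_submodule \<Gamma> R A \<Delta>_part)"
      using extend_ideal[OF U] by (auto simp: graded_submodule_def)
    fix V assume "V \<in> Collect (graded_submodule \<Gamma> corner (corner_grading \<Gamma> A \<Delta>) corner)" and UV: "U \<subset> V"
    then have "restrict (extend V) = V" by (auto simp: graded_submodule_def restrict_extend)
    then show "extend U \<subset> extend V"
      using UV restrict_extend[OF U] extend_mono[of U V] by (metis psubset_eq)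
  qed
qed

text \<open>Simplicity means being minimal above 0, which an isomorphism of submodule lattices
  preserves.\<close>

lemma gr_simple_restrict:
  assumes U: "gr_ideal U" "U \<subseteq> \<Delta>_part" "gr_simple \<Gamma> R A U"
  shows "gr_simple \<Gamma> corner (corner_grading \<Gamma> A \<Delta>) (restrict U)"
  unfolding gr_simple_def
proof (intro conjI allI impI)
  note ext = extend_restrict[OF U(1,2)]
  show "restrict U \<noteq> {0}" using U(3) ext extend_zero by (auto simp: gr_simple_def)
  fix V assume "graded_submodule \<Gamma> corner (corner_grading \<Gamma> A \<Delta>) (restrict U) V"
  then have V: "corner.gr_ideal V" "V \<subseteq> restrict U" by (auto simp: graded_submodule_def)
  then have "graded_submodule \<Gamma> R A U (extend V)"
    using extend_ideal[OF V(1)] extend_mono[OF V(2)] ext by (auto simp: graded_submodule_def)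
  then have "extend V = {0} \<or> extend V = U" using U(3) by (simp add: gr_simple_def)
  then show "V = {0} \<or> V = restrict U" using restrict_extend[OF V(1)] restrict_zero by auto
qed

lemma gr_simple_extend:
  assumes V: "corner.gr_ideal V" "gr_simple \<Gamma> corner (corner_grading \<Gamma> A \<Delta>) V"
  shows "gr_simple \<Gamma> R A (extend V)"
  unfolding gr_simple_def
proof (intro conjI allI impI)
  note ext = restrict_extend[OF V(1)]
  show "extend V \<noteq> {0}" using V(2) ext restrict_zero by (auto simp: gr_simple_def)
  fix U assume "graded_submodule \<Gamma> R A (extend V) U"
  then have U: "gr_ideal U" "U \<subseteq> extend V" by (auto simp: graded_submodule_def)
  then have U': "U \<subseteq> \<Delta>_part" using extend_ideal(2)[OF V(1)] by auto
  then have "graded_submodule \<Gamma> corner (corner_grading \<Gamma> A \<Delta>) V (restrict U)"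
    using restrict_ideal[OF U(1) U'] restrict_mono[OF U(2)] ext by (auto simp: graded_submodule_def)
  then have "restrict U = {0} \<or> restrict U = V" using V(2) by (simp add: gr_simple_def)
  then show "U = {0} \<or> U = extend V" using extend_restrict[OF U(1) U'] extend_zero by auto
qed

text \<open>Simple summands are carried across by \<open>restrict\<close> and \<open>extend\<close>:
  multiplying a decomposition by \<open>unit\<close> on the right descends to the corner,
  multiplying by \<open>R\<close> ascends to \<open>u R\<close>.\<close>

lemma gr_semisimple_corner_iff:
  "gr_semisimple \<Gamma> corner (corner_grading \<Gamma> A \<Delta>) corner \<longleftrightarrow>
    (\<forall>e\<in>\<Delta>. gr_semisimple \<Gamma> R A (right_piece R A e))"
proof
  assume "\<forall>e\<in>\<Delta>. gr_semisimple \<Gamma> R A (right_piece R A e)"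
  then have "gr_semisimple \<Gamma> R A \<Delta>_part" unfolding \<Delta>_part_eq by (intro gr_semisimple_Union) auto
  then have P: "\<Delta>_part \<subseteq> group_closure (\<Union>(simples \<Delta>_part))"
    by (simp add: gr_semisimple_iff[OF gr_ideal_\<Delta>_part])
  have "x * unit \<in> group_closure (\<Union>(corner.simples corner))" if "x \<in> corner" for x
  proof (rule group_closure_map[where f = "\<lambda>x. x * unit", OF _ add_subgroup_group_closure])
    show "x \<in> group_closure (\<Union>(simples \<Delta>_part))"
      using P that by (auto simp: corner_eq \<Delta>_part_def)
    fix s assume "s \<in> \<Union>(simples \<Delta>_part)"
    then obtain S where S: "s \<in> S" "gr_ideal S" "S \<subseteq> \<Delta>_part" "gr_simple \<Gamma> R A S"
      by (auto simp: graded_submodule_def)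
    have "restrict S \<in> corner.simples corner"
      using restrict_ideal[OF S(2,3)] gr_simple_restrict[OF S(2,3,4)] corner.gr_idealD(1)
      by (auto simp: graded_submodule_def)
    then show "s * unit \<in> group_closure (\<Union>(corner.simples corner))"
      using unit_mult_in_restrict[OF S(2,1)] by (intro group_closure_incl) blast
  qed (simp add: left_diff_distrib)
  then have "corner \<subseteq> group_closure (\<Union>(corner.simples corner))" by (auto simp: corner_eq)
  then show "gr_semisimple \<Gamma> corner (corner_grading \<Gamma> A \<Delta>) corner"
    by (simp add: corner.gr_semisimple_iff[OF corner.gr_ideal_R])
next
  assume "gr_semisimple \<Gamma> corner (corner_grading \<Gamma> A \<Delta>) corner"
  then have C: "corner \<subseteq> group_closure (\<Union>(corner.simples corner))"
    by (simp add: corner.gr_semisimple_iff[OF corner.gr_ideal_R])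
  have "v * r \<in> group_closure (\<Union>(simples \<Delta>_part))" if "v \<in> corner" "r \<in> R" for v r
  proof (rule group_closure_map[where f = "\<lambda>x. x * r", OF _ add_subgroup_group_closure])
    show "v \<in> group_closure (\<Union>(corner.simples corner))" using C that by blast
    fix s assume "s \<in> \<Union>(corner.simples corner)"
    then obtain S where S: "s \<in> S" "corner.gr_ideal S" "gr_simple \<Gamma> corner (corner_grading \<Gamma> A \<Delta>) S"
      by (auto simp: graded_submodule_def)
    have "extend S \<in> simples \<Delta>_part"
      using extend_ideal[OF S(2)] gr_simple_extend[OF S(2,3)] by (auto simp: graded_submodule_def)
    moreover have "s * r \<in> extend S"
      unfolding extend_def using S(1) that(2) by (intro group_closure_incl) blast
    ultimately show "s * r \<in> group_closure (\<Union>(simples \<Delta>_part))" by (intro group_closure_incl) blast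
  qed (simp add: left_diff_distrib)
  then have "extend corner \<subseteq> group_closure (\<Union>(simples \<Delta>_part))"
    unfolding extend_def by (intro group_closure_least add_subgroup_group_closure) auto
  then have P: "gr_semisimple \<Gamma> R A \<Delta>_part"
    using extend_restrict[OF gr_ideal_\<Delta>_part] restrict_\<Delta>_part
    by (simp add: gr_semisimple_iff[OF gr_ideal_\<Delta>_part])
  show "\<forall>e\<in>\<Delta>. gr_semisimple \<Gamma> R A (right_piece R A e)"
  proof
    fix e assume e: "e \<in> \<Delta>"
    then have "e \<in> Mor \<Gamma>" "one_at A e \<in> A e" using \<Delta> identsD one_at_in by auto
    \<comment> \<open>R(e) is obtained from \<open>u R\<close> as an image, because
      \<open>one_at A e * unit = one_at A e\<close>; semisimplicity of submodules is thereby
      avoided.\<close>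
    then have "gr_semisimple \<Gamma> R A ((*) (one_at A e) ` \<Delta>_part)" by (intro gr_semisimple_image P)
    also have "(*) (one_at A e) ` \<Delta>_part = right_piece R A e"
      unfolding \<Delta>_part_alt right_piece_def using unit_one_at(2)[OF e]
      by (auto simp: mult.assoc[symmetric] image_iff) (metis mult.assoc)
    finally show "gr_semisimple \<Gamma> R A (right_piece R A e)" .
  qed
qed

text \<open>For any object \<open>e\<close>, R(e) is the principal right ideal of
  \<open>one_at A e\<close>, so \<open>chain_cond_principal\<close> reaches objects outside
  \<Delta>.\<close>

lemma objectwise_chain_cond_iff:
  assumes "rel \<in> {(\<subset>), (\<supset>)}"
  shows "(\<forall>e\<in>idents \<Gamma>. chain_cond rel (right_piece R A e)) \<longleftrightarrow>
    (\<forall>e\<in>\<Delta>. chain_cond rel (right_piece R A e))"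
proof
  assume "\<forall>e\<in>\<Delta>. chain_cond rel (right_piece R A e)"
  then show "\<forall>e\<in>idents \<Gamma>. chain_cond rel (right_piece R A e)"
    using chain_cond_principal[OF assms, of "one_at A e" for e] one_at_R
    by (simp add: right_piece_def[of R A "e" for e])
qed (use \<Delta> in auto)

end

theorem proposition8p4:
  fixes \<Gamma> :: "'g arrows" and R :: "'r::ring set" and A :: "'g \<Rightarrow> 'r set" and \<Delta> :: "'g set"
  assumes "groupoid \<Gamma>"
    and "graded_ring \<Gamma> R A"
    and "d_finitely_generated \<Gamma> R A"
    and "d_generating \<Gamma> R A \<Delta>"
  shows
    "((right_objectwise_artinian \<Gamma> R A
        \<longleftrightarrow> right_gr_artinian_ring \<Gamma> (corner_ring R A \<Delta>) (corner_grading \<Gamma> A \<Delta>))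
      \<and> (right_gr_artinian_ring \<Gamma> (corner_ring R A \<Delta>) (corner_grading \<Gamma> A \<Delta>)
        \<longleftrightarrow> (\<forall>e\<in>\<Delta>. gr_artinian \<Gamma> R A (right_piece R A e))))
     \<and> ((right_objectwise_noetherian \<Gamma> R A
        \<longleftrightarrow> right_gr_noetherian_ring \<Gamma> (corner_ring R A \<Delta>) (corner_grading \<Gamma> A \<Delta>))
      \<and> (right_gr_noetherian_ring \<Gamma> (corner_ring R A \<Delta>) (corner_grading \<Gamma> A \<Delta>)
        \<longleftrightarrow> (\<forall>e\<in>\<Delta>. gr_noetherian \<Gamma> R A (right_piece R A e))))
     \<and> ((gr_semisimple_ring \<Gamma> R A
        \<longleftrightarrow> gr_semisimple_ring \<Gamma> (corner_ring R A \<Delta>) (corner_grading \<Gamma> A \<Delta>))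
      \<and> (gr_semisimple_ring \<Gamma> (corner_ring R A \<Delta>) (corner_grading \<Gamma> A \<Delta>)
        \<longleftrightarrow> (\<forall>e\<in>\<Delta>. gr_semisimple \<Gamma> R A (right_piece R A e))))"
proof -
  interpret d_generated_ring \<Gamma> R A \<Delta>
    by (intro d_generated_ring.intro d_generated_ring_axioms.intro assms)
  show ?thesis
    unfolding right_objectwise_artinian_def right_gr_artinian_ring_def gr_artinian_iff
      right_objectwise_noetherian_def right_gr_noetherian_ring_def gr_noetherian_iff gr_semisimple_ring_def
    by (simp add: objectwise_chain_cond_iff chain_cond_corner_iff gr_semisimple_corner_iff gr_semisimple_ring_iff)
qed

end
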